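(* Let $n\in\{1,2\}$, let $p\in[1,\infty)$ be fixed with conjugate exponent $q$ ($1=1/p+1/q$), and let $k$ be a fixed integer with $k>2/p+n+2$. Then there is a constant $C$ which depends only on $n$ (for the fixed $p$ and $k$), and in particular not on $N,h,r,R$, the particles or the stencils, such that for all reals $h>0$, $R>r>0$, every particle cloud $\omega=\sum_{i=1}^N\Gamma_i\delta(\mathbf{x}-\mathbf{x}_i)$ and every family of admissible stencils $(f_{ij})_{1\le i,j\le N}$ of order $n$ (as defined in the context), $$\left\Vert \Delta\omega-\Delta_h\omega\right\Vert_{W^{-k,q}}\le C\left(\frac{R}{r}\right)^2(Rh)^n\,\Vert(\Gamma_i)\Vert_{l^1}.$$
   Context: Particle cloud: $N\ge1$, positions $\mathbf{x}_1,\dots,\mathbf{x}_N\in\mathbb{R}^2$, circulations $\Gamma_1,\dots,\Gamma_N\in\mathbb{R}$, and $\omega=\sum_{i=1}^N\Gamma_i\delta(\mathbf{x}-\mathbf{x}_i)$ with $\delta$ the Dirac distribution; $\Vert(\Gamma_i)\Vert_{l^1}=\sum_i|\Gamma_i|$. $\mathbf{r}_{ij}:=\mathbf{x}_j-\mathbf{x}_i$ with Cartesian components $\mathbf{r}_{ij}^x,\mathbf{r}_{ij}^y$; for a multi-index $\alpha=(\alpha_1,\alpha_2)$, $\mathbf{r}_{ij}^\alpha=(\mathbf{r}_{ij}^x)^{\alpha_1}(\mathbf{r}_{ij}^y)^{\alpha_2}$. Neighbourhood of particle $i$: $\mathcal{N}_i:=\{j\in\{1,\dots,N\}: rh\le|\mathbf{x}_i-\mathbf{x}_j|\le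 Rh\}\cup\{i\}$. Admissible stencils of order $n$: real numbers $f_{ij}$ with $f_{ij}=0$ for $j\notin\mathcal{N}_i$ such that for every $i$ the following hold: $f_{ij}\ge0$ for all $j\ne i$; $\sum_{j=1}^Nf_{ij}\mathbf{r}_{ij}^x\mathbf{r}_{ij}^x=2$, $\sum_{j=1}^Nf_{ij}\mathbf{r}_{ij}^y\mathbf{r}_{ij}^y=2$, $\sum_{j=1}^Nf_{ij}\mathbf{r}_{ij}^x\mathbf{r}_{ij}^y=0$; and $\sum_{j=1}^Nf_{ij}\mathbf{r}_{ij}^\alpha=0$ for all multi-indices $\alpha$ with $0\le|\alpha|\le n+1$, $|\alpha|\ne2$. (The case $\alpha=(0,0)$ means $f_{ii}=-\sum_{j\ne i}f_{ij}$.) For indices $i$ with $\Gamma_i=0$ (empty particles) it is also allowed that $f_{ij}=0$ for all $j$ instead. Discrete Laplacian: $\Delta_h\omega:=\sum_{i=1}^N\sum_{j=1}^Nf_{ij}\Gamma_i\delta(\mathbf{x}-\mathbf{x}_j)$. $\Delta\omega$ is the distributional Laplacian, $\langle\Delta\omega,\varphi\rangle=\sum_i\Gamma_i\Delta\varphi(\mathbf{x}_i)$. Norms: $W^{k,p}$ is the Sobolev space of $k$ times weakly differentiable $L^p(\mathbb{R}^2)$-functions, $W^{-k,q}$ is its dual space, with $\Vert\mu\Vert_{W^{-k,q}}=\sup_{0\ne\varphi\in W^{k,p}}\langle\mu,\varphi\rangle/\Vert\varphi\Vert_{W^{k,p}}$. By the Sobolev embedding theorem $W^{k,p}\hookrightarrow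 C^{n+2}$ (with the maximum norm over all derivatives up to order $n+2$), so point evaluations of $\varphi\in W^{k,p}$ and its derivatives up to order $n+2$ make sense. *)

theory Defs
  imports "HOL-Analysis.Analysis"
begin

text \<open>The plane is modelled by \<^typ>\<open>real \<times> real\<close>, whose norm and distance are the Euclidean ones
  and whose \<^term>\<open>lborel\<close> is two-dimensional Lebesgue measure.\<close>

type_synonym plane = "real \<times> real"
type_synonym multi_index = "nat \<times> nat"

abbreviation midx_size :: "multi_index \<Rightarrow> nat" where
  "midx_size \<alpha> \<equiv> fst \<alpha> + snd \<alpha>"

definition mpower :: "plane \<Rightarrow> multi_index \<Rightarrow> real" where
  "mpower v \<alpha> = fst v ^ fst \<alpha> * snd v ^ snd \<alpha>"


section \<open>Classical derivatives and test functions\<close>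

definition partial_x :: "(plane \<Rightarrow> real) \<Rightarrow> plane \<Rightarrow> real" where
  "partial_x \<phi> = (\<lambda>(a, b). deriv (\<lambda>t. \<phi> (t, b)) a)"

definition partial_y :: "(plane \<Rightarrow> real) \<Rightarrow> plane \<Rightarrow> real" where
  "partial_y \<phi> = (\<lambda>(a, b). deriv (\<lambda>t. \<phi> (a, t)) b)"

definition mpartial :: "multi_index \<Rightarrow> (plane \<Rightarrow> real) \<Rightarrow> plane \<Rightarrow> real" where
  "mpartial \<alpha> \<phi> = (partial_x ^^ fst \<alpha>) ((partial_y ^^ snd \<alpha>) \<phi>)"

definition laplacian :: "(plane \<Rightarrow> real) \<Rightarrow> plane \<Rightarrow> real" where
  "laplacian \<phi> = (\<lambda>z. mpartial (2, 0) \<phi> z + mpartial (0, 2) \<phi> z)"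

text \<open>\<open>cont_diff m\<close> is the class $C^m$. The differentiability requirement guarantees that the values of
  \<^const>\<open>deriv\<close> in the partial derivatives are genuine derivatives.\<close>

primrec cont_diff :: "nat \<Rightarrow> (plane \<Rightarrow> real) \<Rightarrow> bool" where
  "cont_diff 0 \<phi> \<longleftrightarrow> continuous_on UNIV \<phi>"
| "cont_diff (Suc m) \<phi> \<longleftrightarrow>
     (\<forall>z. \<phi> differentiable (at z)) \<and> cont_diff m (partial_x \<phi>) \<and> cont_diff m (partial_y \<phi>)"

definition test_function :: "(plane \<Rightarrow> real) \<Rightarrow> bool" where
  "test_function \<phi> \<longleftrightarrow> (\<forall>m. cont_diff m \<phi>) \<and> (\<exists>K. compact K \<and> (\<forall>z. z \<notin> K \<longrightarrow> \<phi> z = 0))"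


section \<open>Sobolev spaces\<close>

definition Lp :: "real \<Rightarrow> (plane \<Rightarrow> real) set" where
  "Lp p = {u. u \<in> borel_measurable lborel \<and> integrable lborel (\<lambda>z. \<bar>u z\<bar> powr p)}"

definition locally_integrable :: "(plane \<Rightarrow> real) \<Rightarrow> bool" where
  "locally_integrable u \<longleftrightarrow> (\<forall>K. compact K \<longrightarrow> set_integrable lborel K u)"

definition is_weak_deriv :: "multi_index \<Rightarrow> (plane \<Rightarrow> real) \<Rightarrow> (plane \<Rightarrow> real) \<Rightarrow> bool" where
  "is_weak_deriv \<alpha> u v \<longleftrightarrow> locally_integrable u \<and> locally_integrable v \<and>
     (\<forall>\<phi>. test_function \<phi> \<longrightarrow>
        (\<integral>z. u z * mpartial \<alpha> \<phi> z \<partial>lborel) = (-1) ^ midx_size \<alpha> * (\<integral>z. v z * \<phi> z \<partial>lborel))"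

definition weak_deriv :: "multi_index \<Rightarrow> (plane \<Rightarrow> real) \<Rightarrow> plane \<Rightarrow> real" where
  "weak_deriv \<alpha> u = (SOME v. v \<in> borel_measurable lborel \<and> is_weak_deriv \<alpha> u v)"

text \<open>Elements of $W^{k,p}$ are represented by functions; functions that agree almost everywhere
  represent the same element. Weak derivatives are unique only almost everywhere, hence the choice in
  \<^const>\<open>weak_deriv\<close>.\<close>

definition sobolev_space :: "nat \<Rightarrow> real \<Rightarrow> (plane \<Rightarrow> real) set" where
  "sobolev_space k p =
     {u. u \<in> Lp p \<and> (\<forall>\<alpha>. midx_size \<alpha> \<le> k \<longrightarrow> (\<exists>v \<in> Lp p. is_weak_deriv \<alpha> u v))}"

definition sobolev_norm :: "nat \<Rightarrow> real \<Rightarrow> (plane \<Rightarrow> real) \<Rightarrow> real" where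
  "sobolev_norm k p u =
     (\<Sum>\<alpha> | midx_size \<alpha> \<le> k. \<integral>z. \<bar>weak_deriv \<alpha> u z\<bar> powr p \<partial>lborel) powr (1 / p)"

text \<open>A class of almost everywhere equal functions contains at most one continuous function, which is
  therefore also its $C^m$ representative whenever it has one. Point evaluations of an element of
  $W^{k,p}$ and of its derivatives refer to this representative.\<close>

definition continuous_rep :: "(plane \<Rightarrow> real) \<Rightarrow> plane \<Rightarrow> real" where
  "continuous_rep u = (THE \<phi>. continuous_on UNIV \<phi> \<and> (AE z in lborel. \<phi> z = u z))"

type_synonym functional = "(plane \<Rightarrow> real) \<Rightarrow> real"

definition sobolev_dual_norm :: "nat \<Rightarrow> real \<Rightarrow> functional \<Rightarrow> ereal" where
  "sobolev_dual_norm k p \<mu> =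
     (SUP \<phi> \<in> {\<phi> \<in> sobolev_space k p. \<not> (AE z in lborel. \<phi> z = 0)}.
        ereal (\<mu> (continuous_rep \<phi>) / sobolev_norm k p \<phi>))"

text \<open>The exponent $p$ with $1/p + 1/q = 1$, for $1 < q \le \infty$.\<close>

definition conjugate_exponent :: "ennreal \<Rightarrow> real" where
  "conjugate_exponent q = enn2real (1 / (1 - 1 / q))"

lemma conjugate_exponent_eq:
  assumes "p \<ge> 1" and "1 / ennreal p + 1 / q = 1"
  shows "conjugate_exponent q = p"
proof -
  have p: "1 / ennreal p = ennreal (1 / p)"
    using assms(1) by (simp add: divide_ennreal[symmetric])
  have "1 - 1 / q = (1 / ennreal p + 1 / q) - 1 / q"
    using assms(2) by simp
  also have "\<dots> = 1 / ennreal p"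
  proof (rule ennreal_add_diff_cancel_right)
    show "1 / q \<noteq> top"
      using assms(2) by auto
  qed
  finally have "1 / (1 - 1 / q) = 1 / ennreal (1 / p)"
    by (simp add: p)
  also have "\<dots> = ennreal p"
    using assms(1) by (simp add: divide_ennreal flip: ennreal_1)
  finally show ?thesis
    using assms(1) by (simp add: conjugate_exponent_def)
qed

text \<open>The norm of $W^{-k,q}$, the dual space of $W^{k,p}$ with $1/p + 1/q = 1$.\<close>

definition neg_sobolev_norm :: "nat \<Rightarrow> ennreal \<Rightarrow> functional \<Rightarrow> ereal" where
  "neg_sobolev_norm k q = sobolev_dual_norm k (conjugate_exponent q)"


section \<open>Particle clouds and stencils\<close>

text \<open>Particles are indexed by \<open>{1..N}\<close>; the values of \<open>\<Gamma>\<close>, \<open>x\<close> and \<open>f\<close> at other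
  indices are irrelevant.\<close>

definition dirac :: "plane \<Rightarrow> functional" where
  "dirac a = (\<lambda>\<phi>. \<phi> a)"

definition cloud :: "nat \<Rightarrow> (nat \<Rightarrow> real) \<Rightarrow> (nat \<Rightarrow> plane) \<Rightarrow> functional" where
  "cloud N \<Gamma> x = (\<lambda>\<phi>. \<Sum>i = 1..N. \<Gamma> i * dirac (x i) \<phi>)"

definition dist_laplacian :: "functional \<Rightarrow> functional" where
  "dist_laplacian \<mu> = (\<lambda>\<phi>. \<mu> (laplacian \<phi>))"

definition discrete_laplacian ::
  "nat \<Rightarrow> (nat \<Rightarrow> nat \<Rightarrow> real) \<Rightarrow> (nat \<Rightarrow> real) \<Rightarrow> (nat \<Rightarrow> plane) \<Rightarrow> functional" where
  "discrete_laplacian N f \<Gamma> x =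
     (\<lambda>\<phi>. \<Sum>i = 1..N. \<Sum>j = 1..N. f i j * \<Gamma> i * dirac (x j) \<phi>)"

definition neighbourhood ::
  "real \<Rightarrow> real \<Rightarrow> real \<Rightarrow> nat \<Rightarrow> (nat \<Rightarrow> plane) \<Rightarrow> nat \<Rightarrow> nat set" where
  "neighbourhood h r R N x i =
     {j \<in> {1..N}. r * h \<le> norm (x i - x j) \<and> norm (x i - x j) \<le> R * h} \<union> {i}"

definition consistent_stencil ::
  "nat \<Rightarrow> nat \<Rightarrow> (nat \<Rightarrow> plane) \<Rightarrow> (nat \<Rightarrow> nat \<Rightarrow> real) \<Rightarrow> nat \<Rightarrow> bool" where
  "consistent_stencil n N x f i \<longleftrightarrow>
     (\<forall>j \<in> {1..N}. j \<noteq> i \<longrightarrow> f i j \<ge> 0) \<and>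
     (\<Sum>j = 1..N. f i j * (fst (x j - x i) * fst (x j - x i))) = 2 \<and>
     (\<Sum>j = 1..N. f i j * (snd (x j - x i) * snd (x j - x i))) = 2 \<and>
     (\<Sum>j = 1..N. f i j * (fst (x j - x i) * snd (x j - x i))) = 0 \<and>
     (\<forall>\<alpha>. midx_size \<alpha> \<le> n + 1 \<and> midx_size \<alpha> \<noteq> 2 \<longrightarrow>
        (\<Sum>j = 1..N. f i j * mpower (x j - x i) \<alpha>) = 0)"

definition admissible_stencils ::
  "nat \<Rightarrow> real \<Rightarrow> real \<Rightarrow> real \<Rightarrow> nat \<Rightarrow> (nat \<Rightarrow> real) \<Rightarrow> (nat \<Rightarrow> plane) \<Rightarrow> (nat \<Rightarrow> nat \<Rightarrow> real) \<Rightarrow> bool" where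
  "admissible_stencils n h r R N \<Gamma> x f \<longleftrightarrow>
     (\<forall>i \<in> {1..N}.
        (\<forall>j \<in> {1..N}. j \<notin> neighbourhood h r R N x i \<longrightarrow> f i j = 0) \<and>
        (consistent_stencil n N x f i \<or> (\<Gamma> i = 0 \<and> (\<forall>j \<in> {1..N}. f i j = 0))))"

end

theory Submission
  imports Defs
begin

text \<open>Taylor expansion of order $n + 2$ around $x_i$ together with the moment conditions reduces the
  consistency error at particle $i$ to the remainder, which is at most a constant times
  $\sum_j f_{ij} |r_{ij}|^{n+2} \sup |D^{n+2}\varphi| \le 4 (Rh)^n \sup |D^{n+2}\varphi|$ because the second
  moments give $\sum_j f_{ij} |r_{ij}|^2 = 4$ and $f_{ij} \ge 0$ for $j \ne i$.

  What remains is the Sobolev embedding. For a mollification $u_\varepsilon$ of $u$, whose derivatives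
  are the mollified weak derivatives, $D^{n+2} u_\varepsilon$ is bounded by $C \|u\|_{k,p}$ uniformly in
  $\varepsilon$: for $p \le 2$ there are two derivatives to spare, and a value is bounded by the
  integrals of $|f|$, $|f_x|$, $|f_y|$, $|f_{xy}|$ over a unit square; for $p > 2$ there is one to
  spare, and one averages $|f(z)| \le |f(z+w)| + \int_0^1 |\nabla f(z+tw)|\,dt$ over $w$ in the unit
  square, using that $t^{-2/p}$ is integrable at $0$. Since mollifications commute, the resulting
  uniform Lipschitz bounds make the lower derivatives of $u_\varepsilon$ converge at rate
  $O(\varepsilon)$, so that no convergence of mollifications in $L^p$ is needed, and the limit is the
  continuous representative of $u$.\<close>

section \<open>Mollifiers on the line\<close>

text \<open>Differentiation under an integral or a limit is handled through inequalities. A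
  quadratic remainder bound survives integration against a locally integrable function and survives
  pointwise limits, and \<open>has_derivative_quadratic_error\<close> turns it back into a
  derivative. This is why bounds reaching two orders higher are what differentiability of the limit
  asks for.

  The averages are computed with values in \<open>ennreal\<close>, where exchanging the order of
  integration asks for measurability alone.

  Origin of the constants: the remainder of order n + 2 has a binomial row sum 2^(n+2), the two pure
  second moments add up to 4, and \<open>sobolev_const\<close> comes from the embedding. The ratio
  (R/r)^2 is what the cruder route produces: the lower distance rh gives a total off-diagonal weight
  of at most 4/(rh)^2, and each remainder is bounded by (Rh)^(n+2). Keeping |r_ij|^2 next to f_ij
  gives 4 (Rh)^n directly, and (R/r)^2 >= 1 then leads to the stated form.\<close>

lemma has_derivative_quadratic_error:
  fixes f :: "'a::real_normed_vector \<Rightarrow> 'b::real_normed_vector"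
  assumes "bounded_linear D" and "d > 0"
    and *: "\<And>h. norm h < d \<Longrightarrow> norm (f (a + h) - f a - D h) \<le> K * (norm h)\<^sup>2"
  shows "(f has_derivative D) (at a)"
  unfolding has_derivative_at
proof (rule conjI[OF assms(1) Lim_null_comparison])
  have "\<forall>\<^sub>F h in at (0::'a). h \<in> ball 0 d - {0}"
    using \<open>d > 0\<close> by (auto simp: eventually_at dist_commute intro!: exI[of _ d])
  then show "\<forall>\<^sub>F h in at (0::'a). norm (norm (f (a + h) - f a - D h) / norm h) \<le> K * norm h"
  proof eventually_elim
    case (elim h)
    then show ?case
      using *[of h] by (simp add: divide_le_eq power2_eq_square mult.assoc)
  qed
  show "((\<lambda>h::'a. K * norm h) \<longlongrightarrow> 0) (at 0)"
    by (intro tendsto_mult_right_zero tendsto_norm_zero tendsto_ident_at)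
qed

lemma has_real_derivative_quadratic_error:
  fixes f :: "real \<Rightarrow> real"
  assumes "d > 0" and "\<And>h. \<bar>h\<bar> < d \<Longrightarrow> \<bar>f (a + h) - f a - D * h\<bar> \<le> K * h\<^sup>2"
  shows "(f has_real_derivative D) (at a)"
  unfolding has_field_derivative_def
proof (rule has_derivative_quadratic_error[OF bounded_linear_mult_right assms(1)])
  show "norm (f (a + h) - f a - D * h) \<le> K * (norm h)\<^sup>2" if "norm h < d" for h
    using assms(2)[of h] that by simp
qed

text \<open>With $s = 1/(1-t^2)$ the functions $P(t) s^m e^{-s}$ are closed under differentiation, as
  $s' = 2ts^2$; \<open>bump_step\<close> is the new polynomial factor for the exponent $m + 2$.\<close>

definition bump :: "real poly \<Rightarrow> nat \<Rightarrow> real \<Rightarrow> real" where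
  "bump P m t = (if \<bar>t\<bar> < 1 then poly P t * (1 / (1 - t\<^sup>2)) ^ m * exp (- (1 / (1 - t\<^sup>2))) else 0)"

text \<open>Since \<open>exp s\<close> exceeds the term s^(m+2)/(m+2)! of its series, s^m e^(-s) is
  at most (m+2)!/s^2 = (m+2)! (1 - t^2)^2 inside the interval. The squared factor is what forces the
  derivative at the endpoints to be 0.\<close>

lemma bump_flat:
  "\<exists>C. \<forall>t. \<bar>bump P m t\<bar> \<le> C * (1 - t\<^sup>2)\<^sup>2"
proof -
  have "compact (poly P ` {-1..1})"
    by (intro compact_continuous_image continuous_intros) auto
  then obtain B where B: "\<And>t. t \<in> {-1..1} \<Longrightarrow> \<bar>poly P t\<bar> \<le> B"
    by (fastforce dest!: compact_imp_bounded simp: bounded_iff)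
  have "B \<ge> 0" using B[of 0] by auto
  have "\<bar>bump P m t\<bar> \<le> (B * fact (m + 2)) * (1 - t\<^sup>2)\<^sup>2" for t
  proof (cases "\<bar>t\<bar> < 1")
    case True
    define s where "s = 1 / (1 - t\<^sup>2)"
    have t2: "1 - t\<^sup>2 > 0" using True by (simp add: abs_square_less_1)
    then have s: "s > 0" by (simp add: s_def)
    have "s ^ (m + 2) / fact (m + 2) \<le> exp s"
    proof -
      have "(\<lambda>k. s ^ k / fact k) sums exp s"
        using exp_converges[of s] by (simp add: field_simps)
      then have "exp s = (\<Sum>k. s ^ k / fact k)" "summable (\<lambda>k. s ^ k / fact k)"
        by (simp_all only: sums_iff)
      then have "(\<Sum>k\<in>{m + 2}. s ^ k / fact k) \<le> exp s"
        using s by (simp only:) (rule sum_le_suminf, auto)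
      moreover have "(\<Sum>k\<in>{m + 2}. s ^ k / fact k) = s ^ (m + 2) / fact (m + 2)"
        by (rule trans[OF sum.insert]) auto
      ultimately show ?thesis by (simp only:)
    qed
    then have "s ^ (m + 2) * exp (- s) \<le> fact (m + 2)"
      by (simp add: exp_minus field_simps del: fact_Suc power_Suc add_2_eq_Suc' add_2_eq_Suc)
    then have "(s ^ (m + 2) * exp (- s)) * (1 - t\<^sup>2)\<^sup>2 \<le> fact (m + 2) * (1 - t\<^sup>2)\<^sup>2"
      by (rule mult_right_mono) simp
    moreover have "(s ^ (m + 2) * exp (- s)) * (1 - t\<^sup>2)\<^sup>2 = s ^ m * exp (- s) * (s * (1 - t\<^sup>2))\<^sup>2"
      by (simp add: power_add power_mult_distrib power2_eq_square)
    moreover have "s * (1 - t\<^sup>2) = 1" using t2 by (simp add: s_def)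
    ultimately have 1: "s ^ m * exp (- s) \<le> fact (m + 2) * (1 - t\<^sup>2)\<^sup>2"
      by (simp only: power_one mult_1_right)
    have "\<bar>bump P m t\<bar> = \<bar>poly P t\<bar> * (s ^ m * exp (- s))"
      using True s by (simp add: bump_def s_def[symmetric] abs_mult)
    also have "\<dots> \<le> B * (fact (m + 2) * (1 - t\<^sup>2)\<^sup>2)"
    proof (rule mult_mono[OF _ 1])
      show "\<bar>poly P t\<bar> \<le> B" using B[of t] True by (simp add: abs_less_iff)
    qed (use s \<open>B \<ge> 0\<close> in auto)
    finally show ?thesis by (simp add: mult.assoc)
  next
    case False
    then show ?thesis using \<open>B \<ge> 0\<close> by (simp add: bump_def)
  qed
  then show ?thesis by blast
qed

definition bump_step :: "nat \<Rightarrow> real poly \<Rightarrow> real poly" where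
  "bump_step m P = pderiv P * [:1, 0, -1:]\<^sup>2 + smult (2 * real m) ([:0, 1:] * P * [:1, 0, -1:]) - smult 2 ([:0, 1:] * P)"

lemma has_real_derivative_bump:
  "(bump P m has_real_derivative bump (bump_step m P) (m + 2) t) (at t)"
proof (cases "\<bar>t\<bar> < 1")
  case True
  let ?s = "\<lambda>t::real. 1 / (1 - t\<^sup>2)"
  have t2: "1 - t\<^sup>2 > 0" using True by (simp add: abs_square_less_1)
  have ds: "(?s has_real_derivative 2 * t * (?s t)\<^sup>2) (at t)"
    using t2 by (auto intro!: derivative_eq_intros simp: power2_eq_square)
  have "((\<lambda>t. poly P t * ?s t ^ m * exp (- ?s t)) has_real_derivative
      (poly (pderiv P) t * ?s t ^ m + poly P t * (real m * ?s t ^ (m - 1) * (2 * t * (?s t)\<^sup>2))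
        - poly P t * ?s t ^ m * (2 * t * (?s t)\<^sup>2)) * exp (- ?s t)) (at t)"
    by (rule derivative_eq_intros ds refl)+ (simp add: algebra_simps)
  also have "(poly (pderiv P) t * ?s t ^ m + poly P t * (real m * ?s t ^ (m - 1) * (2 * t * (?s t)\<^sup>2))
        - poly P t * ?s t ^ m * (2 * t * (?s t)\<^sup>2)) = poly (bump_step m P) t * ?s t ^ (m + 2)"
  proof -
    \<comment> \<open>With w = 1 - t^2 and v = 1/w, the relation w v = 1 brings all three terms to
      the common power v^(m+2); the powers of w left over are those in
      \<open>bump_step\<close>.\<close>
    define w where "w = 1 - t\<^sup>2"
    have w: "w \<noteq> 0" using t2 by (simp add: w_def)
    have "poly [:1, 0, -1:] t = w" "poly [:0, 1:] t = t"
      by (simp_all add: w_def power2_eq_square)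
    then have "poly (bump_step m P) t = poly (pderiv P) t * w\<^sup>2 + 2 * m * (t * poly P t * w) - 2 * (t * poly P t)"
      by (simp only: bump_step_def poly_add poly_diff poly_mult poly_smult poly_power)
    note step = this
    define v where "v = 1 / w"
    have vw: "w * v = 1" using w by (simp add: v_def)
    \<comment> \<open>For m = 0 truncated subtraction gives m - 1 = 0, but the factor
      \<open>real m\<close> makes both sides 0.\<close>
    have "real m * v ^ (m - 1) * v\<^sup>2 = real m * w * v ^ (m + 2)"
    proof (cases m)
      case (Suc k)
      have "w * v ^ (Suc k + 2) = (w * v) * (v ^ k * v\<^sup>2)"
        by (simp add: power2_eq_square)
      also have "\<dots> = v ^ (m - 1) * v\<^sup>2" using Suc vw by simp
      finally show ?thesis using Suc by (simp only: mult.assoc)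
    qed simp
    moreover have "poly P t * (real m * v ^ (m - 1) * (2 * t * v\<^sup>2)) = 2 * t * poly P t * (real m * v ^ (m - 1) * v\<^sup>2)"
      by (simp only: mult_ac)
    ultimately have "poly P t * (real m * v ^ (m - 1) * (2 * t * v\<^sup>2)) = 2 * t * poly P t * (real m * w * v ^ (m + 2))"
      by (simp only:)
    moreover have "v ^ m = w\<^sup>2 * v ^ (m + 2)"
    proof -
      have "w\<^sup>2 * v ^ (m + 2) = (w * v)\<^sup>2 * v ^ m"
        by (simp add: power_mult_distrib power_add power2_eq_square)
      then show ?thesis using vw by simp
    qed
    then have "poly (pderiv P) t * v ^ m = poly (pderiv P) t * (w\<^sup>2 * v ^ (m + 2))" by simp
    moreover have "poly P t * v ^ m * (2 * t * v\<^sup>2) = 2 * t * poly P t * v ^ (m + 2)"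
      by (simp add: power_add power2_eq_square)
    ultimately show ?thesis
      unfolding w_def[symmetric] v_def[symmetric] step by (simp only: distrib_left right_diff_distrib distrib_right left_diff_distrib of_nat_mult of_nat_numeral mult_ac)
  qed
  finally have "((\<lambda>t. poly P t * ?s t ^ m * exp (- ?s t)) has_real_derivative
      bump (bump_step m P) (m + 2) t) (at t)"
    using True by (simp add: bump_def)
  moreover have "\<forall>\<^sub>F s in nhds t. \<bar>s\<bar> < 1"
    using True by (intro eventually_nhds_in_open[of "{-1<..<1}", THEN eventually_mono]) auto
  then have "\<forall>\<^sub>F s in nhds t. poly P s * ?s s ^ m * exp (- ?s s) = bump P m s"
    by eventually_elim (simp add: bump_def)
  ultimately show ?thesis
    by (subst (asm) DERIV_cong_ev) auto
next
  case False
  obtain C where C: "\<And>t. \<bar>bump P m t\<bar> \<le> C * (1 - t\<^sup>2)\<^sup>2"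
    using bump_flat[of P m] by blast
  have "C \<ge> 0" using C[of 0] by simp
  \<comment> \<open>Endpoints and exterior points are treated together: if |s| < 1 <= |t|, then 1 -
    s^2 = (1 - |s|)(1 + |s|) <= 2 |s - t|, so flatness gives the error 4C (s - t)^2.\<close>
  have "((bump P m) has_real_derivative 0) (at t)"
  proof (rule has_real_derivative_quadratic_error[of 1 _ _ _ "4 * C"])
    fix h
    define s where "s = t + h"
    have "\<bar>bump P m s - bump P m t - 0 * (s - t)\<bar> \<le> 4 * C * (s - t)\<^sup>2"
    proof (cases "\<bar>s\<bar> < 1")
      case True
      have 2: "0 \<le> 1 - s\<^sup>2" using True by (simp add: abs_square_le_1)
      have "1 - s\<^sup>2 = (1 - \<bar>s\<bar>) * (1 + \<bar>s\<bar>)"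
        by (simp add: power2_eq_square left_diff_distrib distrib_left)
      also have "\<dots> \<le> \<bar>s - t\<bar> * 2"
        using True False by (intro mult_mono) auto
      finally have "(1 - s\<^sup>2)\<^sup>2 \<le> (\<bar>s - t\<bar> * 2)\<^sup>2"
        using 2 by (intro power_mono) auto
      then have "C * (1 - s\<^sup>2)\<^sup>2 \<le> C * (4 * (s - t)\<^sup>2)"
        using \<open>C \<ge> 0\<close> by (intro mult_left_mono) (auto simp: power_mult_distrib)
      with C[of s] False show ?thesis
        by (simp add: bump_def[of P m t])
    qed (use \<open>C \<ge> 0\<close> False in \<open>auto simp: bump_def\<close>)
    then show "\<bar>bump P m (t + h) - bump P m t - 0 * h\<bar> \<le> 4 * C * h\<^sup>2"
      by (simp add: s_def)
  qed simp
  then show ?thesis using False by (simp add: bump_def)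
qed

text \<open>A mollifier is carried as the whole sequence of its derivatives, so differentiating
  means raising an index, and smoothness is part of the data.\<close>

definition mollifier :: "real \<Rightarrow> (nat \<Rightarrow> real \<Rightarrow> real) \<Rightarrow> bool" where
  "mollifier e b \<longleftrightarrow> (\<forall>i t. (b i has_real_derivative b (Suc i) t) (at t)) \<and>
     (\<forall>i t. \<bar>t\<bar> > e \<longrightarrow> b i t = 0) \<and> (\<forall>t. b 0 t \<ge> 0) \<and> (\<integral>t. b 0 t \<partial>lborel) = 1"

lemma mollifier_exists:
  assumes e: "e > 0"
  shows "\<exists>b. mollifier e b"
proof -
  \<comment> \<open>Each differentiation raises the exponent of 1/(1 - t^2) by 2, so the i-th
    derivative has exponent 2 i, starting from the polynomial 1.\<close>
  define P where "P = rec_nat (1 :: real poly) (\<lambda>i. bump_step (2 * i))"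
  define g where "g i = bump (P i) (2 * i)" for i
  have g': "(g i has_real_derivative g (Suc i) t) (at t)" for i t
    using has_real_derivative_bump[of "P i" "2 * i" t] by (simp add: g_def P_def)
  have g0: "g i t = 0" if "\<bar>t\<bar> \<ge> 1" for i t
    using that by (simp add: g_def bump_def)
  have gpos: "g 0 t > 0" if "\<bar>t\<bar> < 1" for t
    using that by (simp add: g_def bump_def P_def)
  have gnn: "g 0 t \<ge> 0" for t
    using gpos[of t] g0[of t 0] by (cases "\<bar>t\<bar> < 1") auto
  define h where "h i t = g i (t / e) / e ^ i" for i t
  have h': "(h i has_real_derivative h (Suc i) t) (at t)" for i t
    unfolding h_def using e
    by (auto intro!: derivative_eq_intros DERIV_chain2[OF g'])
  have h0: "h i t = 0" if "\<bar>t\<bar> > e" for i t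
    using that e by (simp add: h_def g0)
  have cont: "continuous_on A (h i)" for A i
    using h' by (meson DERIV_isCont continuous_at_imp_continuous_on)
  have int: "integrable lborel (h 0)"
  proof -
    have "set_integrable lborel {-e..e} (h 0)"
      unfolding set_integrable_def by (intro borel_integrable_compact cont) auto
    moreover have "(\<lambda>t. indicat_real {-e..e} t *\<^sub>R h 0 t) = h 0"
    proof
      fix t show "indicat_real {-e..e} t *\<^sub>R h 0 t = h 0 t"
    proof (cases "t \<in> {-e..e}")
      case False
      then have "\<bar>t\<bar> > e" by auto
      then show ?thesis using h0 by simp
    qed simp
    qed
    ultimately show ?thesis
      by (simp add: set_integrable_def)
  qed
  define c where "c = (\<integral>t. h 0 t \<partial>lborel)"
  have hnn: "h 0 t \<ge> 0" for t using gnn by (simp add: h_def)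
  have "c \<noteq> 0"
  proof
    assume "c = 0"
    then have "AE t in lborel. h 0 t = 0"
      using integral_nonneg_eq_0_iff_AE[OF int] hnn by (simp add: c_def)
    then have "AE t in lborel. t \<notin> {-e<..<e}"
    proof eventually_elim
      fix t assume "h 0 t = 0"
      then show "t \<notin> {-e<..<e}" using gpos[of "t / e"] e by (auto simp: h_def abs_less_iff)
    qed
    then have "{-e<..<e} \<in> null_sets lborel"
      by (subst (asm) AE_iff_null_sets[symmetric]) auto
    then show False using e by (simp add: null_sets_def)
  qed
  moreover have "c \<ge> 0" unfolding c_def by (rule integral_nonneg_AE) (simp add: hnn)
  ultimately have c: "c > 0" by simp
  have "mollifier e (\<lambda>i t. h i t / c)"
    unfolding mollifier_def
    using c h' h0 hnn by (auto intro: DERIV_cdivide simp: c_def[symmetric])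
  then show ?thesis by blast
qed

section \<open>Mollification in the plane\<close>

text \<open>The kernel is a product, so its mixed partial derivatives commute by construction; symmetry of
  mixed derivatives is never needed.\<close>

definition kern :: "(nat \<Rightarrow> real \<Rightarrow> real) \<Rightarrow> nat \<Rightarrow> nat \<Rightarrow> plane \<Rightarrow> real" where
  "kern b i j z = b i (fst z) * b j (snd z)"

text \<open>This is the derivative of order (i, j) of the mollification of \<open>u\<close>, with
  the derivatives placed on the kernel; \<open>has_derivative_conv\<close> justifies this
  reading.\<close>

definition conv :: "(nat \<Rightarrow> real \<Rightarrow> real) \<Rightarrow> (plane \<Rightarrow> real) \<Rightarrow> nat \<Rightarrow> nat \<Rightarrow> plane \<Rightarrow> real" where
  "conv b u i j z = (\<integral>y. u y * kern b i j (z - y) \<partial>lborel)"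

lemma mollifierD:
  assumes "mollifier e b"
  shows "(b i has_real_derivative b (Suc i) t) (at t)" and "\<bar>t\<bar> > e \<Longrightarrow> b i t = 0"
    and "b 0 t \<ge> 0" and "(\<integral>t. b 0 t \<partial>lborel) = 1"
  using assms by (auto simp: mollifier_def)

lemma DERIV_mollifier_comp:
  assumes "mollifier e b" "(g has_real_derivative g') (at t)" "D = b (Suc i) (g t) * g'"
  shows "((\<lambda>t. b i (g t)) has_real_derivative D) (at t)"
  using DERIV_chain2[OF mollifierD(1)[OF assms(1)] assms(2)] assms(3) by simp

lemma mollifier_continuous_on: "mollifier e b \<Longrightarrow> continuous_on A (b i)"
  using mollifierD(1) by (meson DERIV_isCont continuous_at_imp_continuous_on)

lemma mollifier_bounded:
  assumes "mollifier e b"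
  shows "\<exists>K\<ge>0. \<forall>t. \<bar>b i t\<bar> \<le> K"
proof -
  have "compact (b i ` {-e..e})"
    by (intro compact_continuous_image mollifier_continuous_on[OF assms]) auto
  then obtain B where B: "\<And>t. t \<in> {-e..e} \<Longrightarrow> \<bar>b i t\<bar> \<le> B"
    by (fastforce dest!: compact_imp_bounded simp: bounded_iff)
  have "\<bar>b i t\<bar> \<le> \<bar>B\<bar>" for t
  proof (cases "t \<in> {-e..e}")
    case False
    then have "\<bar>t\<bar> > e" by auto
    then show ?thesis using mollifierD(2)[OF assms] by simp
  qed (use B[of t] in auto)
  then show ?thesis using abs_ge_zero by blast
qed

lemma mollifier_taylor:
  assumes "mollifier e b"
  shows "\<exists>K\<ge>0. (\<forall>t. \<bar>b i t\<bar> \<le> K) \<and> (\<forall>t. \<bar>b (Suc i) t\<bar> \<le> K) \<and>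
    (\<forall>t h. \<bar>b i (t + h) - b i t\<bar> \<le> K * \<bar>h\<bar>) \<and>
    (\<forall>t h. \<bar>b i (t + h) - b i t - b (Suc i) t * h\<bar> \<le> K * h\<^sup>2)"
proof -
  obtain K0 where K0: "K0 \<ge> 0" "\<And>t. \<bar>b i t\<bar> \<le> K0" using mollifier_bounded[OF assms] by blast
  obtain K1 where K1: "K1 \<ge> 0" "\<And>t. \<bar>b (Suc i) t\<bar> \<le> K1" using mollifier_bounded[OF assms] by blast
  obtain K2 where K2: "K2 \<ge> 0" "\<And>t. \<bar>b (Suc (Suc i)) t\<bar> \<le> K2" using mollifier_bounded[OF assms] by blast
  define K where "K = K0 + K1 + K2"
  have mac: "\<exists>s. \<bar>s\<bar> \<le> \<bar>h\<bar> \<and> b i (t + h) = (\<Sum>m<n. b (i + m) (t + 0) / fact m * h ^ m) + b (i + n) (t + s) / fact n * h ^ n" for t h n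
    by (rule Maclaurin_all_le[of "\<lambda>m s. b (i + m) (t + s)"])
      (auto intro!: DERIV_mollifier_comp[OF assms] derivative_eq_intros)
  show ?thesis
  proof (intro exI[of _ K] conjI allI)
    fix t h
    obtain s where s: "b i (t + h) - b i t = b (Suc i) (t + s) * h"
      using mac[where n = 1 and t = t and h = h] by (auto simp: algebra_simps intro: that)
    show "\<bar>b i (t + h) - b i t\<bar> \<le> K * \<bar>h\<bar>"
      unfolding s abs_mult using K0 K2 by (intro mult_right_mono order_trans[OF K1(2)]) (auto simp: K_def)
    obtain s where s: "b i (t + h) - b i t - b (Suc i) t * h = b (Suc (Suc i)) (t + s) / 2 * h\<^sup>2"
      using mac[where n = 2 and t = t and h = h] by (auto simp: numeral_2_eq_2 intro: that)
    have "\<bar>b (Suc (Suc i)) (t + s) / 2\<bar> \<le> K"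
      using K2(2)[of "t + s"] K2(1) K1 K0 unfolding K_def by (simp add: abs_le_iff)
    then show "\<bar>b i (t + h) - b i t - b (Suc i) t * h\<bar> \<le> K * h\<^sup>2"
      unfolding s abs_mult by (simp only: abs_power2 mult_right_mono zero_le_power2)
  next
    fix t
    show "\<bar>b i t\<bar> \<le> K" "\<bar>b (Suc i) t\<bar> \<le> K"
      using K0(1) K0(2)[of t] K1(1) K1(2)[of t] K2(1) by (simp_all add: K_def)
  qed (use K0(1) K1(1) K2(1) in \<open>simp add: K_def\<close>)
qed

text \<open>The support is a square of half side e, and 2 e is a simple upper bound for its half
  diagonal. The same 2 e recurs in all later support and distance estimates.\<close>

lemma kern_zero:
  assumes "mollifier e b" "norm z > 2 * e"
  shows "kern b i j z = 0"
proof (rule ccontr)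
  assume "kern b i j z \<noteq> 0"
  then have "\<bar>fst z\<bar> \<le> e" "\<bar>snd z\<bar> \<le> e"
    using mollifierD(2)[OF assms(1)] by (force simp: kern_def)+
  moreover have "norm z \<le> \<bar>fst z\<bar> + \<bar>snd z\<bar>"
    using norm_Pair_le[of "fst z" "snd z"] by simp
  ultimately show False using assms(2) by simp
qed

lemma kern_nonneg: "mollifier e b \<Longrightarrow> kern b 0 0 z \<ge> 0"
  by (simp add: kern_def mollifierD(3))

lemma continuous_on_kern: "mollifier e b \<Longrightarrow> continuous_on A (kern b i j)"
  unfolding kern_def
  by (rule continuous_on_mult; rule continuous_on_compose2[OF mollifier_continuous_on[of e b UNIV]])
    (auto intro: continuous_intros)

lemma kern_measurable [measurable]: "mollifier e b \<Longrightarrow> kern b i j \<in> borel_measurable borel"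
  by (intro borel_measurable_continuous_onI continuous_on_kern)

lemma abs_fst_le_norm: "\<bar>fst (z::plane)\<bar> \<le> norm z"
  using norm_fst_le[of "fst z" "snd z"] by simp

lemma abs_snd_le_norm: "\<bar>snd (z::plane)\<bar> \<le> norm z"
  using norm_snd_le[of "snd z" "fst z"] by simp

lemma kern_taylor:
  assumes "mollifier e b"
  shows "\<exists>K\<ge>0. \<forall>z h. \<bar>kern b i j (z + h) - kern b i j z -
    (fst h * kern b (Suc i) j z + snd h * kern b i (Suc j) z)\<bar> \<le> K * (norm h)\<^sup>2"
proof -
  obtain K where K: "K \<ge> 0" "\<And>t. \<bar>b i t\<bar> \<le> K" "\<And>t. \<bar>b (Suc i) t\<bar> \<le> K"
    "\<And>t h. \<bar>b i (t + h) - b i t - b (Suc i) t * h\<bar> \<le> K * h\<^sup>2"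
    using mollifier_taylor[OF assms, of i] by metis
  obtain L where L: "L \<ge> 0" "\<And>t. \<bar>b j t\<bar> \<le> L" "\<And>t h. \<bar>b j (t + h) - b j t\<bar> \<le> L * \<bar>h\<bar>"
    "\<And>t h. \<bar>b j (t + h) - b j t - b (Suc j) t * h\<bar> \<le> L * h\<^sup>2"
    using mollifier_taylor[OF assms, of j] by metis
  show ?thesis
  proof (intro exI[of _ "3 * (K * L)"] conjI allI)
    fix z h :: plane
    obtain s t g k where zh: "z = (s, t)" "h = (g, k)" by (cases z; cases h)
    have gk: "\<bar>g\<bar> \<le> norm h" "\<bar>k\<bar> \<le> norm h"
      using abs_fst_le_norm[of h] abs_snd_le_norm[of h] zh by auto
    have gk2: "g\<^sup>2 \<le> (norm h)\<^sup>2" "k\<^sup>2 \<le> (norm h)\<^sup>2" "\<bar>g\<bar> * \<bar>k\<bar> \<le> (norm h)\<^sup>2"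
      using power_mono[OF gk(1), of 2] power_mono[OF gk(2), of 2] mult_mono[OF gk]
      by (simp_all add: power2_eq_square)
    \<comment> \<open>The remainder of a product splits into a second-order remainder of each factor
      and a product of two first-order increments; each piece is quadratic in the norm of h.\<close>
    let ?R1 = "(b i (s + g) - b i s - b (Suc i) s * g) * b j (t + k)"
    let ?R2 = "b i s * (b j (t + k) - b j t - b (Suc j) t * k)"
    let ?R3 = "b (Suc i) s * g * (b j (t + k) - b j t)"
    have "kern b i j (z + h) - kern b i j z - (fst h * kern b (Suc i) j z + snd h * kern b i (Suc j) z)
       = ?R1 + ?R2 + ?R3"
      by (simp add: kern_def zh algebra_simps)
    moreover have "\<bar>?R1\<bar> \<le> (K * g\<^sup>2) * L"
      unfolding abs_mult using K L by (intro mult_mono) auto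
    moreover have "\<bar>?R2\<bar> \<le> K * (L * k\<^sup>2)"
      unfolding abs_mult using K L by (intro mult_mono) auto
    moreover have "\<bar>?R3\<bar> \<le> (K * \<bar>g\<bar>) * (L * \<bar>k\<bar>)"
      unfolding abs_mult using K L by (intro mult_mono) auto
    moreover have "(K * g\<^sup>2) * L \<le> (K * L) * (norm h)\<^sup>2" "K * (L * k\<^sup>2) \<le> (K * L) * (norm h)\<^sup>2"
      "(K * \<bar>g\<bar>) * (L * \<bar>k\<bar>) \<le> (K * L) * (norm h)\<^sup>2"
      using gk2[THEN mult_left_mono, of "K * L"] K(1) L(1) by (simp_all add: algebra_simps)
    ultimately show "\<bar>kern b i j (z + h) - kern b i j z - (fst h * kern b (Suc i) j z + snd h * kern b i (Suc j) z)\<bar>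
        \<le> 3 * (K * L) * (norm h)\<^sup>2"
      by linarith
  qed (use K L in auto)
qed

lemma integrable_mult_compact_support:
  fixes g :: "plane \<Rightarrow> real"
  assumes "locally_integrable u" "continuous_on UNIV g" "compact K" "\<And>y. y \<notin> K \<Longrightarrow> g y = 0"
  shows "integrable lborel (\<lambda>y. u y * g y)"
proof -
  have K: "integrable lborel (\<lambda>y. indicator K y *\<^sub>R u y)"
    using assms by (simp add: locally_integrable_def set_integrable_def)
  have "compact (g ` K)"
    using assms(2,3) by (intro compact_continuous_image) (auto intro: continuous_on_subset)
  then obtain B where B: "\<And>y. y \<in> K \<Longrightarrow> \<bar>g y\<bar> \<le> B"
    by (fastforce dest!: compact_imp_bounded simp: bounded_iff)
  have eq: "(\<lambda>y. u y * g y) = (\<lambda>y. (indicator K y *\<^sub>R u y) * g y)"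
    using assms(4) by (auto simp: fun_eq_iff indicator_def)
  have g: "g \<in> borel_measurable lborel"
    using assms(2) by (simp add: borel_measurable_continuous_onI)
  show ?thesis
  proof (rule Bochner_Integration.integrable_bound)
    show "integrable lborel (\<lambda>y. \<bar>B\<bar> * (indicator K y *\<^sub>R u y))" using K by simp
    show "(\<lambda>y. u y * g y) \<in> borel_measurable lborel"
      unfolding eq by (rule borel_measurable_times[OF borel_measurable_integrable[OF K] g])
    have "\<bar>u y * g y\<bar> \<le> \<bar>B\<bar> * \<bar>indicator K y *\<^sub>R u y\<bar>" for y
    proof (cases "y \<in> K")
      case True
      then have "\<bar>g y\<bar> \<le> \<bar>B\<bar>" using B[of y] by linarith
      then show ?thesis using True by (simp add: abs_mult mult.commute[of "\<bar>u y\<bar>"] mult_right_mono)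
    qed (use assms(4) in auto)
    then show "AE y in lborel. norm (u y * g y) \<le> norm (\<bar>B\<bar> * (indicator K y *\<^sub>R u y))"
      by (auto simp: abs_mult)
  qed
qed

lemma conv_integrable:
  assumes "mollifier e b" "locally_integrable u"
  shows "integrable lborel (\<lambda>y. u y * kern b i j (z - y))"
proof (rule integrable_mult_compact_support[OF assms(2)])
  show "continuous_on UNIV (\<lambda>y. kern b i j (z - y))"
    by (rule continuous_on_compose2[OF continuous_on_kern[OF assms(1), of UNIV]])
      (auto intro: continuous_intros)
  show "kern b i j (z - y) = 0" if "y \<notin> cball z (2 * e)" for y
    using that by (intro kern_zero[OF assms(1)]) (auto simp: dist_norm)
qed auto

lemma conv_taylor:
  assumes b: "mollifier e b" and u: "locally_integrable u"
  shows "\<exists>K. \<forall>h. norm h < 1 \<longrightarrow> \<bar>conv b u i j (z + h) - conv b u i j z -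
       (fst h * conv b u (Suc i) j z + snd h * conv b u i (Suc j) z)\<bar> \<le> K * (norm h)\<^sup>2"
proof -
  obtain K where K: "K \<ge> 0"
    "\<And>z h. \<bar>kern b i j (z + h) - kern b i j z - (fst h * kern b (Suc i) j z + snd h * kern b i (Suc j) z)\<bar> \<le> K * (norm h)\<^sup>2"
    using kern_taylor[OF b, of i j] by blast
  \<comment> \<open>For shifts of norm below 1, all kernels involved vanish outside this one ball,
    so the integral of |u| over it supplies a constant independent of h, although u is only locally
    integrable.\<close>
  define Q where "Q = cball z (2 * e + 1)"
  have Q: "integrable lborel (\<lambda>y. indicator Q y *\<^sub>R u y)"
    using u by (simp add: locally_integrable_def set_integrable_def Q_def)
  show ?thesis
  proof (intro exI[of _ "K * (\<integral>y. \<bar>indicator Q y *\<^sub>R u y\<bar> \<partial>lborel)"] allI impI)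
    fix h :: plane assume h: "norm h < 1"
    let ?D = "\<lambda>y. kern b i j (z + h - y) - kern b i j (z - y) -
      (fst h * kern b (Suc i) j (z - y) + snd h * kern b i (Suc j) (z - y))"
    have D: "\<bar>?D y\<bar> \<le> K * (norm h)\<^sup>2" for y
      using K(2)[of "z - y" h] by (simp add: algebra_simps)
    have D0: "?D y = 0" if "y \<notin> Q" for y
    proof -
      have zy: "norm (z - y) > 2 * e + 1" using that by (simp add: Q_def dist_norm)
      have "norm (z - y) \<le> norm (z + h - y) + norm h"
        using norm_triangle_ineq4[of "z + h - y" h] by (simp add: algebra_simps)
      then have "norm (z + h - y) > 2 * e" using zy h by simp
      then show ?thesis using zy by (simp add: kern_zero[OF b])
    qed
    note int = conv_integrable[OF b u]
    have "conv b u i j (z + h) - conv b u i j z -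
       (fst h * conv b u (Suc i) j z + snd h * conv b u i (Suc j) z) = (\<integral>y. u y * ?D y \<partial>lborel)"
    proof -
      have "(\<integral>y. u y * ?D y \<partial>lborel) = (\<integral>y. (u y * kern b i j (z + h - y) - u y * kern b i j (z - y)) -
        (fst h * (u y * kern b (Suc i) j (z - y)) + snd h * (u y * kern b i (Suc j) (z - y))) \<partial>lborel)"
        by (rule Bochner_Integration.integral_cong) (simp_all add: algebra_simps)
      also have "\<dots> = conv b u i j (z + h) - conv b u i j z -
       (fst h * conv b u (Suc i) j z + snd h * conv b u i (Suc j) z)"
        by (simp add: conv_def int)
      finally show ?thesis ..
    qed
    also have "\<bar>\<dots>\<bar> \<le> (\<integral>y. K * (norm h)\<^sup>2 * \<bar>indicator Q y *\<^sub>R u y\<bar> \<partial>lborel)"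
    proof (rule integral_abs_bound_integral)
      show "integrable lborel (\<lambda>y. u y * ?D y)"
      proof (rule Bochner_Integration.integrable_cong[OF refl, THEN iffD1])
        show "integrable lborel (\<lambda>y. (u y * kern b i j (z + h - y) - u y * kern b i j (z - y)) -
          (fst h * (u y * kern b (Suc i) j (z - y)) + snd h * (u y * kern b i (Suc j) (z - y))))"
          by (simp add: int)
      qed (simp add: algebra_simps)
      show "integrable lborel (\<lambda>y. K * (norm h)\<^sup>2 * \<bar>indicator Q y *\<^sub>R u y\<bar>)"
        using Q by (intro integrable_mult_right integrable_abs)
      fix y
      show "\<bar>u y * ?D y\<bar> \<le> K * (norm h)\<^sup>2 * \<bar>indicator Q y *\<^sub>R u y\<bar>"
      proof (cases "y \<in> Q")
        case True
        then show ?thesis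
          using mult_right_mono[OF D, of "\<bar>u y\<bar>" y] by (simp add: abs_mult mult_ac)
      next
        case False
        from D0[OF this] show ?thesis by (simp only: mult_zero_right abs_zero) (use K(1) in simp)
      qed
    qed
    finally show "\<bar>conv b u i j (z + h) - conv b u i j z -
       (fst h * conv b u (Suc i) j z + snd h * conv b u i (Suc j) z)\<bar>
        \<le> K * (\<integral>y. \<bar>indicator Q y *\<^sub>R u y\<bar> \<partial>lborel) * (norm h)\<^sup>2"
      by (simp add: mult_ac)
  qed
qed

lemma has_derivative_conv:
  assumes b: "mollifier e b" and u: "locally_integrable u"
  shows "(conv b u i j has_derivative (\<lambda>h. fst h * conv b u (Suc i) j z + snd h * conv b u i (Suc j) z)) (at z)"
proof -
  obtain K where K:
    "\<And>h. norm h < 1 \<Longrightarrow> \<bar>conv b u i j (z + h) - conv b u i j z -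
       (fst h * conv b u (Suc i) j z + snd h * conv b u i (Suc j) z)\<bar> \<le> K * (norm h)\<^sup>2"
    using conv_taylor[OF b u] by blast
  show ?thesis
    by (rule has_derivative_quadratic_error[of _ 1 _ _ K])
      (use K in \<open>auto intro!: bounded_linear_intros\<close>)
qed

lemma continuous_on_conv:
  assumes "mollifier e b" "locally_integrable u"
  shows "continuous_on A (conv b u i j)"
  using has_derivative_conv[OF assms]
  by (meson continuous_at_imp_continuous_on has_derivative_continuous)

lemma partial_prod:
  assumes "\<And>i t. (A i has_real_derivative A (Suc i) t) (at t)" "\<And>i t. (B i has_real_derivative B (Suc i) t) (at t)"
  shows "partial_x (\<lambda>(s, t). A i s * B j t) = (\<lambda>(s, t). A (Suc i) s * B j t)"
    and "partial_y (\<lambda>(s, t). A i s * B j t) = (\<lambda>(s, t). A i s * B (Suc j) t)"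
  unfolding partial_x_def partial_y_def fun_eq_iff
  using assms by (auto intro!: DERIV_imp_deriv derivative_eq_intros)

lemma mpartial_prod:
  assumes "\<And>i t. (A i has_real_derivative A (Suc i) t) (at t)" "\<And>i t. (B i has_real_derivative B (Suc i) t) (at t)"
  shows "mpartial (i, j) (\<lambda>(s, t). A 0 s * B 0 t) = (\<lambda>(s, t). A i s * B j t)"
proof -
  have y: "(partial_y ^^ j) (\<lambda>(s, t). A 0 s * B 0 t) = (\<lambda>(s, t). A 0 s * B j t)" for j
    by (induction j) (simp_all add: partial_prod(2)[of A B, OF assms])
  have "(partial_x ^^ i) (\<lambda>(s, t). A 0 s * B j t) = (\<lambda>(s, t). A i s * B j t)" for i
    by (induction i) (simp_all add: partial_prod(1)[of A B, OF assms])
  then show ?thesis by (simp add: mpartial_def y)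
qed

lemma cont_diff_prod:
  assumes "\<And>i t. (A i has_real_derivative A (Suc i) t) (at t)" "\<And>i t. (B i has_real_derivative B (Suc i) t) (at t)"
  shows "cont_diff m (\<lambda>(s, t). A i s * B j t)"
proof -
  have d: "((\<lambda>z. A i (fst z) * B j (snd z)) has_derivative
      (\<lambda>h. A i (fst z) * (snd h * B (Suc j) (snd z)) + fst h * A (Suc i) (fst z) * B j (snd z))) (at z)" for i j and z :: plane
    by (rule derivative_eq_intros has_derivative_compose[OF _ has_derivative_at_withinI, OF _ assms(1)[unfolded has_field_derivative_def]]
       has_derivative_compose[OF _ has_derivative_at_withinI, OF _ assms(2)[unfolded has_field_derivative_def]] refl)+
      (simp add: mult_ac fun_eq_iff)
  then have diff: "(\<lambda>(s, t). A i s * B j t) differentiable at z" for i j and z :: plane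
    unfolding differentiable_def case_prod_beta by blast
  show ?thesis
  proof (induction m arbitrary: i j)
    case 0
    show ?case
      using diff by (simp add: differentiable_imp_continuous_on differentiable_on_def differentiable_at_withinI)
  next
    case (Suc m)
    then show ?case using diff by (simp add: partial_prod[of A B, OF assms])
  qed
qed

text \<open>The reflected kernel y -> k(z - y) is itself a test function. Differentiating it in y
  produces the sign (-1)^(i+j), built into \<open>A\<close> and \<open>B\<close>, which cancels the
  sign in the definition of the weak derivative.\<close>

lemma conv_weak_deriv:
  assumes b: "mollifier e b" and w: "is_weak_deriv (i, j) u v"
  shows "conv b u i j z = conv b v 0 0 z"
proof -
  define A where "A i s = (-1) ^ i * b i (fst z - s)" for i s
  define B where "B i s = (-1) ^ i * b i (snd z - s)" for i s
  have A: "(A i has_real_derivative A (Suc i) t) (at t)" for i t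
    unfolding A_def by (auto intro!: derivative_eq_intros DERIV_mollifier_comp[OF b])
  have B: "(B i has_real_derivative B (Suc i) t) (at t)" for i t
    unfolding B_def by (auto intro!: derivative_eq_intros DERIV_mollifier_comp[OF b])
  define \<phi> where "\<phi> = (\<lambda>(s, t). A 0 s * B 0 t)"
  have phi: "\<phi> y = kern b 0 0 (z - y)" for y
    by (simp add: \<phi>_def A_def B_def kern_def case_prod_beta)
  have "\<phi> y = 0" if "y \<notin> cball z (2 * e)" for y
    using that unfolding phi by (intro kern_zero[OF b]) (auto simp: dist_norm)
  then have "test_function \<phi>"
    unfolding test_function_def
    by (intro conjI allI exI[of _ "cball z (2 * e)"])
      (use cont_diff_prod[of A B, OF A B] in \<open>simp_all add: \<phi>_def\<close>)
  then have "(\<integral>y. u y * mpartial (i, j) \<phi> y \<partial>lborel) = (-1) ^ (i + j) * (\<integral>y. v y * \<phi> y \<partial>lborel)"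
    using w by (auto simp: is_weak_deriv_def)
  moreover have "mpartial (i, j) \<phi> = (\<lambda>y. (-1) ^ (i + j) * kern b i j (z - y))"
    unfolding \<phi>_def mpartial_prod[of A B, OF A B]
    by (auto simp: A_def B_def kern_def power_add)
  ultimately show ?thesis
    by (simp add: conv_def phi mult.left_commute[of "u _"])
qed

section \<open>Change of variables and averages over scaled unit squares\<close>

lemma nn_integral_lborel_affine:
  fixes t :: "'a::euclidean_space"
  assumes [measurable]: "f \<in> borel_measurable borel" and c: "c \<noteq> 0"
  shows "(\<integral>\<^sup>+x. f x \<partial>lborel) = ennreal (\<bar>c\<bar> ^ DIM('a)) * (\<integral>\<^sup>+x. f (t + c *\<^sub>R x) \<partial>lborel)"
  by (subst lborel_affine[OF c, of t])
    (simp add: nn_integral_density nn_integral_distr nn_integral_cmult)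

lemma nn_integral_lborel_reflect:
  fixes z :: "'a::euclidean_space"
  assumes "f \<in> borel_measurable borel"
  shows "(\<integral>\<^sup>+x. f (z - x) \<partial>lborel) = (\<integral>\<^sup>+x. f x \<partial>lborel)"
  using nn_integral_lborel_affine[OF assms, of "-1" z] by simp

definition unit_square :: "plane set" where
  "unit_square = {0..1} \<times> {0..1}"

lemma unit_square_measurable [measurable]: "unit_square \<in> sets borel"
  unfolding unit_square_def by (intro borel_closed closed_Times) auto

lemma emeasure_unit_square: "emeasure lborel unit_square = 1"
  unfolding unit_square_def lborel_prod[symmetric]
  by (subst lborel.emeasure_pair_measure_Times) auto

text \<open>Optimized over $A$, this replaces Hoelder's inequality, at the cost of a factor 2.\<close>

lemma abs_le_power_bound:
  fixes g A p :: real
  assumes "A > 0" "p \<ge> 1"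
  shows "\<bar>g\<bar> \<le> A + A powr (1 - p) * \<bar>g\<bar> powr p"
proof (cases "\<bar>g\<bar> \<le> A")
  case False
  then have g: "\<bar>g\<bar> > 0" using assms by auto
  have "\<bar>g\<bar> = \<bar>g\<bar> powr (1 - p) * \<bar>g\<bar> powr p"
    using g by (simp flip: powr_add)
  also have "\<dots> \<le> A powr (1 - p) * \<bar>g\<bar> powr p"
    using False assms by (intro mult_right_mono powr_mono2') auto
  finally show ?thesis using assms by simp
qed (simp add: add_increasing2)

text \<open>Scaling by t in the plane multiplies the integral of |v|^p by t^(-2). Choosing A with
  A^p = t^(-2) S^p balances the two terms of \<open>abs_le_power_bound\<close>, each contributing A;
  hence the factor 2 and the exponent -2/p.\<close>

lemma square_bound:
  fixes v :: "plane \<Rightarrow> real"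
  assumes [measurable]: "v \<in> borel_measurable borel"
    and p: "p \<ge> 1" and S: "S > 0" and t: "t > 0"
    and v: "(\<integral>\<^sup>+y. ennreal (\<bar>v y\<bar> powr p) \<partial>lborel) \<le> ennreal (S powr p)"
  shows "(\<integral>\<^sup>+w\<in>unit_square. ennreal \<bar>v (a + t *\<^sub>R w)\<bar> \<partial>lborel) \<le> ennreal (2 * t powr (- 2 / p) * S)"
proof -
  define A where "A = t powr (- 2 / p) * S"
  have A: "A > 0" using S t by (simp add: A_def)
  have "(\<integral>\<^sup>+w\<in>unit_square. ennreal \<bar>v (a + t *\<^sub>R w)\<bar> \<partial>lborel)
      \<le> (\<integral>\<^sup>+w. ennreal A * indicator unit_square w
          + ennreal (A powr (1 - p)) * ennreal (\<bar>v (a + t *\<^sub>R w)\<bar> powr p) \<partial>lborel)"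
    using abs_le_power_bound[OF A p, of "v (a + t *\<^sub>R w)" for w] A
    by (intro nn_integral_mono)
      (auto simp: indicator_def ennreal_mult[symmetric] ennreal_plus[symmetric] simp del: ennreal_plus intro!: ennreal_leI)
  also have "\<dots> = ennreal A + ennreal (A powr (1 - p)) * (\<integral>\<^sup>+w. ennreal (\<bar>v (a + t *\<^sub>R w)\<bar> powr p) \<partial>lborel)"
    by (simp add: nn_integral_add nn_integral_cmult nn_integral_cmult_indicator emeasure_unit_square)
  also have "\<dots> \<le> ennreal A + ennreal (A powr (1 - p)) * (ennreal (1 / t\<^sup>2) * ennreal (S powr p))"
  proof (intro add_left_mono mult_left_mono)
    have "(\<integral>\<^sup>+w. ennreal (\<bar>v (a + t *\<^sub>R w)\<bar> powr p) \<partial>lborel)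
      = ennreal (1 / t\<^sup>2) * (\<integral>\<^sup>+y. ennreal (\<bar>v y\<bar> powr p) \<partial>lborel)"
      using nn_integral_lborel_affine[of "\<lambda>y. ennreal (\<bar>v y\<bar> powr p)" t a] t
      by (simp add: mult.assoc[symmetric] ennreal_mult[symmetric] power2_eq_square)
    also have "\<dots> \<le> ennreal (1 / t\<^sup>2) * ennreal (S powr p)"
      by (intro mult_left_mono v) auto
    finally show "(\<integral>\<^sup>+w. ennreal (\<bar>v (a + t *\<^sub>R w)\<bar> powr p) \<partial>lborel) \<le> ennreal (1 / t\<^sup>2) * ennreal (S powr p)" .
  qed auto
  also have "ennreal A + ennreal (A powr (1 - p)) * (ennreal (1 / t\<^sup>2) * ennreal (S powr p))
     = ennreal (A + A powr (1 - p) * (1 / t\<^sup>2 * S powr p))"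
    using A by (simp add: ennreal_mult[symmetric] ennreal_plus[symmetric] del: ennreal_plus)
  also have "A powr (1 - p) * (1 / t\<^sup>2 * S powr p) = A"
  proof -
    have "A powr p = t powr (- 2) * S powr p"
      using p t S by (simp add: A_def powr_mult powr_powr)
    also have "t powr (- 2) = 1 / t\<^sup>2"
      using t by (simp add: powr_minus divide_inverse)
    finally have "1 / t\<^sup>2 * S powr p = A powr p" ..
    then show ?thesis using A by (simp flip: powr_add)
  qed
  finally show ?thesis by (simp add: A_def mult_ac)
qed

text \<open>The integral of a non-integrable function has the default value 0, so the value 1
  already certifies integrability.\<close>

lemma mollifier_integrable:
  assumes "mollifier e b"
  shows "integrable lborel (b 0)"
  using mollifierD(4)[OF assms] not_integrable_integral_eq by fastforce

lemma nn_integral_kern: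
  assumes b: "mollifier e b"
  shows "(\<integral>\<^sup>+y. ennreal (kern b 0 0 y) \<partial>lborel) = 1"
proof -
  have [measurable]: "b 0 \<in> borel_measurable borel"
    by (intro borel_measurable_continuous_onI mollifier_continuous_on[OF b])
  have 1: "(\<integral>\<^sup>+t. ennreal (b 0 t) \<partial>lborel) = 1"
    using nn_integral_eq_integral[OF mollifier_integrable[OF b]] mollifierD(3,4)[OF b] by simp
  have "(\<integral>\<^sup>+y. ennreal (kern b 0 0 y) \<partial>lborel) = (\<integral>\<^sup>+s. \<integral>\<^sup>+t. ennreal (b 0 s) * ennreal (b 0 t) \<partial>lborel \<partial>lborel)"
    unfolding lborel_prod[symmetric] kern_def
    by (subst lborel.nn_integral_fst[symmetric]) (auto simp: ennreal_mult' mollifierD(3)[OF b])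
  also have "\<dots> = 1"
    by (simp add: nn_integral_cmult 1)
  finally show ?thesis .
qed

lemma abs_conv_le:
  assumes b: "mollifier e b" and [measurable]: "v \<in> borel_measurable borel"
  shows "ennreal \<bar>conv b v 0 0 z\<bar> \<le> (\<integral>\<^sup>+y. ennreal \<bar>v (z - y)\<bar> * ennreal (kern b 0 0 y) \<partial>lborel)"
proof -
  note [measurable] = kern_measurable[OF b]
  have "ennreal \<bar>conv b v 0 0 z\<bar> \<le> (\<integral>\<^sup>+y. ennreal \<bar>v y * kern b 0 0 (z - y)\<bar> \<partial>lborel)"
    using integral_norm_bound_ennreal[of lborel "\<lambda>y. v y * kern b 0 0 (z - y)"]
    unfolding conv_def
    by (cases "integrable lborel (\<lambda>y. v y * kern b 0 0 (z - y))") (auto simp: not_integrable_integral_eq)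
  also have "\<dots> = (\<integral>\<^sup>+y. ennreal \<bar>v (z - y) * kern b 0 0 (z - (z - y))\<bar> \<partial>lborel)"
    by (rule nn_integral_lborel_reflect[symmetric]) measurable
  finally show ?thesis
    by (simp add: abs_mult ennreal_mult kern_nonneg[OF b])
qed

text \<open>Mollifying averages translates of v, and \<open>square_bound\<close> is uniform in the
  translation; as the kernel has mass 1, the same bound holds for the mollification, whatever e
  is.\<close>

lemma conv_square_bound:
  assumes b: "mollifier e b" and [measurable]: "v \<in> borel_measurable borel"
    and p: "p \<ge> 1" and S: "S > 0" and t: "t > 0"
    and v: "(\<integral>\<^sup>+y. ennreal (\<bar>v y\<bar> powr p) \<partial>lborel) \<le> ennreal (S powr p)"
  shows "(\<integral>\<^sup>+w\<in>unit_square. ennreal \<bar>conv b v 0 0 (a + t *\<^sub>R w)\<bar> \<partial>lborel) \<le> ennreal (2 * t powr (- 2 / p) * S)"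
proof -
  note [measurable] = kern_measurable[OF b]
  let ?B = "ennreal (2 * t powr (- 2 / p) * S)"
  have "(\<integral>\<^sup>+w\<in>unit_square. ennreal \<bar>conv b v 0 0 (a + t *\<^sub>R w)\<bar> \<partial>lborel)
    \<le> (\<integral>\<^sup>+w. (\<integral>\<^sup>+y. ennreal (kern b 0 0 y) * (ennreal \<bar>v (a - y + t *\<^sub>R w)\<bar> * indicator unit_square w) \<partial>lborel) \<partial>lborel)"
  proof (rule nn_integral_mono)
    fix w
    show "ennreal \<bar>conv b v 0 0 (a + t *\<^sub>R w)\<bar> * indicator unit_square w
      \<le> (\<integral>\<^sup>+y. ennreal (kern b 0 0 y) * (ennreal \<bar>v (a - y + t *\<^sub>R w)\<bar> * indicator unit_square w) \<partial>lborel)"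
      using abs_conv_le[OF b, of v "a + t *\<^sub>R w"]
      by (auto simp: indicator_def algebra_simps)
  qed
  also have "\<dots> = (\<integral>\<^sup>+y. (\<integral>\<^sup>+w. ennreal (kern b 0 0 y) * (ennreal \<bar>v (a - y + t *\<^sub>R w)\<bar> * indicator unit_square w) \<partial>lborel) \<partial>lborel)"
    by (rule lborel_pair.Fubini') simp
  also have "\<dots> = (\<integral>\<^sup>+y. ennreal (kern b 0 0 y) * (\<integral>\<^sup>+w\<in>unit_square. ennreal \<bar>v (a - y + t *\<^sub>R w)\<bar> \<partial>lborel) \<partial>lborel)"
    by (simp add: nn_integral_cmult)
  also have "\<dots> \<le> (\<integral>\<^sup>+y. ennreal (kern b 0 0 y) * ?B \<partial>lborel)"
    by (intro nn_integral_mono mult_left_mono square_bound p S t v) auto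
  also have "\<dots> = ?B"
    by (simp add: nn_integral_multc nn_integral_kern[OF b])
  finally show ?thesis .
qed

section \<open>Pointwise bounds for mollified Sobolev functions\<close>

lemma has_derivative_imp_deriv_along:
  fixes f fx fy :: "plane \<Rightarrow> real"
  assumes "\<And>z. (f has_derivative (\<lambda>h. fst h * fx z + snd h * fy z)) (at z)"
  shows "((\<lambda>t. f (z + t *\<^sub>R w)) has_real_derivative fst w * fx (z + t *\<^sub>R w) + snd w * fy (z + t *\<^sub>R w)) (at t within A)"
proof -
  have "((\<lambda>t. z + t *\<^sub>R w) has_derivative (\<lambda>t. t *\<^sub>R w)) (at t within A)"
    by (auto intro!: derivative_eq_intros)
  from has_derivative_compose[OF this assms[of "z + t *\<^sub>R w"]] show ?thesis
    unfolding has_field_derivative_def by (rule has_derivative_eq_rhs) (auto simp: algebra_simps)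
qed

lemma ennreal_abs_le_segment:
  fixes G g :: "real \<Rightarrow> real"
  assumes G: "\<And>s. (G has_real_derivative g s) (at s)" and g: "continuous_on UNIV g"
    and s: "0 \<le> s" "s \<le> 1"
  shows "ennreal \<bar>G 0\<bar> \<le> ennreal \<bar>G s\<bar> + (\<integral>\<^sup>+s\<in>{0..1}. ennreal \<bar>g s\<bar> \<partial>lborel)"
proof -
  have gs: "continuous_on A g" for A using g continuous_on_subset by blast
  have [measurable]: "g \<in> borel_measurable borel" by (intro borel_measurable_continuous_onI g)
  have "(g has_integral (G s - G 0)) {0..s}"
    using s by (intro fundamental_theorem_of_calculus)
      (auto intro: has_field_derivative_at_within G simp flip: has_real_derivative_iff_has_vector_derivative)
  then have "G s - G 0 = integral {0..s} g" by (simp add: integral_unique)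
  also have "\<dots> = (\<integral>x. indicator {0..s} x *\<^sub>R g x \<partial>lborel)"
    using set_borel_integral_eq_integral(2)[OF borel_integrable_atLeastAtMost'[OF gs], of 0 s]
    by (simp add: set_lebesgue_integral_def)
  finally have "ennreal \<bar>G s - G 0\<bar> = ennreal (norm (\<integral>x. indicator {0..s} x *\<^sub>R g x \<partial>lborel))" by simp
  also have "\<dots> \<le> (\<integral>\<^sup>+x. norm (indicator {0..s} x *\<^sub>R g x) \<partial>lborel)"
    using borel_integrable_atLeastAtMost'[OF gs, of 0 s]
    by (intro integral_norm_bound_ennreal) (simp add: set_integrable_def)
  also have "\<dots> \<le> (\<integral>\<^sup>+s\<in>{0..1}. ennreal \<bar>g s\<bar> \<partial>lborel)"
    using s by (intro nn_integral_mono) (auto simp: indicator_def)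
  finally have 1: "ennreal \<bar>G s - G 0\<bar> \<le> (\<integral>\<^sup>+s\<in>{0..1}. ennreal \<bar>g s\<bar> \<partial>lborel)" .
  have "ennreal \<bar>G 0\<bar> \<le> ennreal (\<bar>G s\<bar> + \<bar>G s - G 0\<bar>)"
    by (rule ennreal_leI) simp
  also have "\<dots> = ennreal \<bar>G s\<bar> + ennreal \<bar>G s - G 0\<bar>" by (simp add: ennreal_plus)
  also have "\<dots> \<le> ennreal \<bar>G s\<bar> + (\<integral>\<^sup>+s\<in>{0..1}. ennreal \<bar>g s\<bar> \<partial>lborel)"
    by (intro add_left_mono 1)
  finally show ?thesis .
qed

lemma ennreal_abs_le_interval:
  fixes G g :: "real \<Rightarrow> real"
  assumes G: "\<And>s. (G has_real_derivative g s) (at s)" and g: "continuous_on UNIV g"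
  shows "ennreal \<bar>G 0\<bar> \<le> (\<integral>\<^sup>+s\<in>{0..1}. (ennreal \<bar>G s\<bar> + ennreal \<bar>g s\<bar>) \<partial>lborel)"
proof -
  have [measurable]: "g \<in> borel_measurable borel" by (intro borel_measurable_continuous_onI g)
  have [measurable]: "G \<in> borel_measurable borel"
    by (intro borel_measurable_continuous_onI) (meson G DERIV_isCont continuous_at_imp_continuous_on)
  let ?I = "\<integral>\<^sup>+s\<in>{0..1}. ennreal \<bar>g s\<bar> \<partial>lborel"
  have "ennreal \<bar>G 0\<bar> = (\<integral>\<^sup>+(s::real)\<in>{0..1}. ennreal \<bar>G 0\<bar> \<partial>lborel)"
    by (subst nn_integral_cmult_indicator) auto
  also have "\<dots> \<le> (\<integral>\<^sup>+s. ennreal \<bar>G s\<bar> * indicator {0..1} s + ?I * indicator {0..1} s \<partial>lborel)"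
    using ennreal_abs_le_segment[OF G g] by (intro nn_integral_mono) (auto simp: indicator_def)
  also have "\<dots> = (\<integral>\<^sup>+s\<in>{0..1}. ennreal \<bar>G s\<bar> \<partial>lborel) + ?I"
    by (subst nn_integral_add) (auto simp: nn_integral_cmult_indicator)
  also have "\<dots> = (\<integral>\<^sup>+s\<in>{0..1}. (ennreal \<bar>G s\<bar> + ennreal \<bar>g s\<bar>) \<partial>lborel)"
    by (subst nn_integral_add[symmetric]) (auto simp: distrib_right)
  finally show ?thesis .
qed

text \<open>The one-dimensional bound in x leaves f and fx on a horizontal segment. Applying it in y
  to each of them brings in fy and the y-derivative fxy of fx, and the iterated integral is one over
  the square.\<close>

lemma abs_le_square_mixed:
  fixes f fx fy fxy fxx :: "plane \<Rightarrow> real"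
  assumes f: "\<And>z. (f has_derivative (\<lambda>h. fst h * fx z + snd h * fy z)) (at z)"
    and fx: "\<And>z. (fx has_derivative (\<lambda>h. fst h * fxx z + snd h * fxy z)) (at z)"
    and fy: "continuous_on UNIV fy" and fxy: "continuous_on UNIV fxy"
  shows "ennreal \<bar>f z\<bar> \<le> (\<integral>\<^sup>+w\<in>unit_square. (ennreal \<bar>f (z + w)\<bar> + ennreal \<bar>fx (z + w)\<bar> +
     ennreal \<bar>fy (z + w)\<bar> + ennreal \<bar>fxy (z + w)\<bar>) \<partial>lborel)"
proof -
  have cf: "continuous_on UNIV f" "continuous_on UNIV fx"
    using f fx by (meson continuous_at_imp_continuous_on has_derivative_continuous)+
  note [measurable] = cf[THEN borel_measurable_continuous_onI] fy[THEN borel_measurable_continuous_onI]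
    fxy[THEN borel_measurable_continuous_onI]
  have line: "continuous_on UNIV (\<lambda>t. c (z + t *\<^sub>R w))" if "continuous_on UNIV c" for c :: "plane \<Rightarrow> real" and z w
    by (rule continuous_on_compose2[OF that]) (auto intro!: continuous_intros)
  have X: "ennreal \<bar>f z\<bar> \<le> (\<integral>\<^sup>+s\<in>{0..1}. (ennreal \<bar>f (z + (s, 0))\<bar> + ennreal \<bar>fx (z + (s, 0))\<bar>) \<partial>lborel)"
    using ennreal_abs_le_interval[OF has_derivative_imp_deriv_along[OF f, of z "(1, 0)"]] line[OF cf(2), of z "(1, 0)"]
    by (simp add: zero_prod_def[symmetric])
  have Y: "ennreal \<bar>f z\<bar> \<le> (\<integral>\<^sup>+t\<in>{0..1}. (ennreal \<bar>f (z + (0, t))\<bar> + ennreal \<bar>fy (z + (0, t))\<bar>) \<partial>lborel)" for z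
    using ennreal_abs_le_interval[OF has_derivative_imp_deriv_along[OF f, of z "(0, 1)"]] line[OF fy, of z "(0, 1)"]
    by (simp add: zero_prod_def[symmetric])
  have XY: "ennreal \<bar>fx z\<bar> \<le> (\<integral>\<^sup>+t\<in>{0..1}. (ennreal \<bar>fx (z + (0, t))\<bar> + ennreal \<bar>fxy (z + (0, t))\<bar>) \<partial>lborel)" for z
    using ennreal_abs_le_interval[OF has_derivative_imp_deriv_along[OF fx, of z "(0, 1)"]] line[OF fxy, of z "(0, 1)"]
    by (simp add: zero_prod_def[symmetric])
  let ?F = "\<lambda>w. ennreal \<bar>f (z + w)\<bar> + ennreal \<bar>fx (z + w)\<bar> + ennreal \<bar>fy (z + w)\<bar> + ennreal \<bar>fxy (z + w)\<bar>"
  note X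
  also have "(\<integral>\<^sup>+s\<in>{0..1}. (ennreal \<bar>f (z + (s, 0))\<bar> + ennreal \<bar>fx (z + (s, 0))\<bar>) \<partial>lborel)
    \<le> (\<integral>\<^sup>+s\<in>{0..1}. (\<integral>\<^sup>+t\<in>{0..1}. ?F (s, t) \<partial>lborel) \<partial>lborel)"
  proof (intro nn_integral_mono mult_right_mono)
    fix s :: real
    have "ennreal \<bar>f (z + (s, 0))\<bar> + ennreal \<bar>fx (z + (s, 0))\<bar>
      \<le> (\<integral>\<^sup>+t\<in>{0..1}. (ennreal \<bar>f (z + (s, 0) + (0, t))\<bar> + ennreal \<bar>fy (z + (s, 0) + (0, t))\<bar>) \<partial>lborel)
       + (\<integral>\<^sup>+t\<in>{0..1}. (ennreal \<bar>fx (z + (s, 0) + (0, t))\<bar> + ennreal \<bar>fxy (z + (s, 0) + (0, t))\<bar>) \<partial>lborel)"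
      by (intro add_mono Y XY)
    also have "\<dots> = (\<integral>\<^sup>+t\<in>{0..1}. ?F (s, t) \<partial>lborel)"
      by (subst nn_integral_add[symmetric]) (auto simp: add_ac distrib_right intro!: nn_integral_cong)
    finally show "ennreal \<bar>f (z + (s, 0))\<bar> + ennreal \<bar>fx (z + (s, 0))\<bar> \<le> (\<integral>\<^sup>+t\<in>{0..1}. ?F (s, t) \<partial>lborel)" .
  qed auto
  also have "\<dots> = (\<integral>\<^sup>+s. (\<integral>\<^sup>+t. ?F (s, t) * indicator unit_square (s, t) \<partial>lborel) \<partial>lborel)"
    by (intro nn_integral_cong) (auto simp: indicator_def unit_square_def intro!: nn_integral_cong)
  also have "\<dots> = (\<integral>\<^sup>+w\<in>unit_square. ?F w \<partial>lborel)"
    unfolding lborel_prod[symmetric]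
    by (rule lborel.nn_integral_fst) (simp add: lborel_prod)
  finally show ?thesis .
qed

text \<open>The fundamental theorem of calculus along z + t w is averaged over w. The integrals are
  exchanged so that, for fixed t, the inner one is an average over a square scaled by t, the form
  bounded by \<open>conv_square_bound\<close>.\<close>

lemma abs_le_square_radial:
  fixes f fx fy :: "plane \<Rightarrow> real"
  assumes f: "\<And>z. (f has_derivative (\<lambda>h. fst h * fx z + snd h * fy z)) (at z)"
    and fx: "continuous_on UNIV fx" and fy: "continuous_on UNIV fy"
  shows "ennreal \<bar>f z\<bar> \<le> (\<integral>\<^sup>+w\<in>unit_square. ennreal \<bar>f (z + w)\<bar> \<partial>lborel) +
     (\<integral>\<^sup>+t\<in>{0..1}. (\<integral>\<^sup>+w\<in>unit_square. (ennreal \<bar>fx (z + t *\<^sub>R w)\<bar> + ennreal \<bar>fy (z + t *\<^sub>R w)\<bar>) \<partial>lborel) \<partial>lborel)"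
proof -
  have cf: "continuous_on UNIV f"
    using f by (meson continuous_at_imp_continuous_on has_derivative_continuous)+
  note [measurable] = cf[THEN borel_measurable_continuous_onI] fy[THEN borel_measurable_continuous_onI]
    fx[THEN borel_measurable_continuous_onI]
  have line: "continuous_on UNIV (\<lambda>t. c (z + t *\<^sub>R w))" if "continuous_on UNIV c" for c :: "plane \<Rightarrow> real" and z w
    by (rule continuous_on_compose2[OF that]) (auto intro!: continuous_intros)
  let ?I = "\<lambda>w. \<integral>\<^sup>+t\<in>{0..1}. (ennreal \<bar>fx (z + t *\<^sub>R w)\<bar> + ennreal \<bar>fy (z + t *\<^sub>R w)\<bar>) \<partial>lborel"
  have "ennreal \<bar>f z\<bar> \<le> ennreal \<bar>f (z + w)\<bar> + ?I w" if w: "w \<in> unit_square" for w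
  proof -
    have "continuous_on UNIV (\<lambda>t. fst w * fx (z + t *\<^sub>R w) + snd w * fy (z + t *\<^sub>R w))"
      by (intro continuous_on_add continuous_on_mult continuous_on_const line fx fy)
    then have "ennreal \<bar>f z\<bar> \<le> ennreal \<bar>f (z + w)\<bar> +
      (\<integral>\<^sup>+t\<in>{0..1}. ennreal \<bar>fst w * fx (z + t *\<^sub>R w) + snd w * fy (z + t *\<^sub>R w)\<bar> \<partial>lborel)"
      using ennreal_abs_le_segment[OF has_derivative_imp_deriv_along[OF f, of z w], of 1]
      by simp
    also have "\<dots> \<le> ennreal \<bar>f (z + w)\<bar> + ?I w"
    proof (intro add_left_mono nn_integral_mono mult_right_mono)
      fix t :: real
      have *: "\<bar>c * a\<bar> \<le> \<bar>a\<bar>" if "c \<in> {0..1}" for c a :: real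
        using that by (simp add: abs_mult mult_left_le_one_le)
      have "\<bar>fst w * fx (z + t *\<^sub>R w)\<bar> \<le> \<bar>fx (z + t *\<^sub>R w)\<bar>" "\<bar>snd w * fy (z + t *\<^sub>R w)\<bar> \<le> \<bar>fy (z + t *\<^sub>R w)\<bar>"
        using w by (auto intro!: * simp: unit_square_def mem_Times_iff)
      then have "\<bar>fst w * fx (z + t *\<^sub>R w) + snd w * fy (z + t *\<^sub>R w)\<bar>
          \<le> \<bar>fx (z + t *\<^sub>R w)\<bar> + \<bar>fy (z + t *\<^sub>R w)\<bar>"
        by linarith
      from ennreal_leI[OF this]
      show "ennreal \<bar>fst w * fx (z + t *\<^sub>R w) + snd w * fy (z + t *\<^sub>R w)\<bar>
          \<le> ennreal \<bar>fx (z + t *\<^sub>R w)\<bar> + ennreal \<bar>fy (z + t *\<^sub>R w)\<bar>"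
        by simp
    qed auto
    finally show ?thesis .
  qed
  then have "(\<integral>\<^sup>+w\<in>unit_square. ennreal \<bar>f z\<bar> \<partial>lborel) \<le> (\<integral>\<^sup>+w. ennreal \<bar>f (z + w)\<bar> * indicator unit_square w
      + ?I w * indicator unit_square w \<partial>lborel)"
    by (intro nn_integral_mono) (auto simp: indicator_def)
  also have "\<dots> = (\<integral>\<^sup>+w\<in>unit_square. ennreal \<bar>f (z + w)\<bar> \<partial>lborel) + (\<integral>\<^sup>+w\<in>unit_square. ?I w \<partial>lborel)"
    by (rule nn_integral_add) auto
  also have "(\<integral>\<^sup>+w\<in>unit_square. ?I w \<partial>lborel) = (\<integral>\<^sup>+w. (\<integral>\<^sup>+t. (ennreal \<bar>fx (z + t *\<^sub>R w)\<bar> + ennreal \<bar>fy (z + t *\<^sub>R w)\<bar>)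
      * indicator {0..1} t * indicator unit_square w \<partial>lborel) \<partial>lborel)"
    by (simp add: nn_integral_multc)
  also have "\<dots> = (\<integral>\<^sup>+t. (\<integral>\<^sup>+w. (ennreal \<bar>fx (z + t *\<^sub>R w)\<bar> + ennreal \<bar>fy (z + t *\<^sub>R w)\<bar>)
      * indicator {0..1} t * indicator unit_square w \<partial>lborel) \<partial>lborel)"
    by (rule lborel_pair.Fubini') simp
  also have "\<dots> = (\<integral>\<^sup>+t\<in>{0..1}. (\<integral>\<^sup>+w\<in>unit_square. (ennreal \<bar>fx (z + t *\<^sub>R w)\<bar> + ennreal \<bar>fy (z + t *\<^sub>R w)\<bar>) \<partial>lborel) \<partial>lborel)"
    by (intro nn_integral_cong, subst nn_integral_multc[symmetric]) (measurable, simp add: mult_ac)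
  finally show ?thesis
    by (simp add: nn_integral_cmult_indicator emeasure_unit_square)
qed

text \<open>For p <= 2, four square averages contribute 2 each. For p > 2, the value contributes 2
  and the two partial derivatives contribute 2 t^(-2/p) each, integrated over [0,1] with total 4/(1
  - 2/p).\<close>

definition sobolev_const :: "real \<Rightarrow> real" where
  "sobolev_const p = (if p \<le> 2 then 8 else 2 + 4 / (1 - 2 / p))"

lemma nn_integral_powr_unit_interval:
  assumes "(a::real) > -1"
  shows "(\<integral>\<^sup>+t\<in>{0..1}. ennreal (t powr a) \<partial>lborel) = ennreal (1 / (a + 1))"
proof -
  have "(\<integral>\<^sup>+t. ennreal (indicator {0..1} t * t powr a) \<partial>lborel) = ennreal (1 / (a + 1))"
    using nn_integral_has_integral_lebesgue[OF _ has_integral_powr_from_0[OF assms, of 1]]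
    by (simp add: nn_integral_completion)
  moreover have "ennreal (indicator {0..1} t * t powr a) = ennreal (t powr a) * indicator {0..1} t" for t
    by (simp add: indicator_def)
  ultimately show ?thesis by simp
qed

lemma conv_bound:
  assumes b: "mollifier e b" and p: "p \<ge> 1" and S: "S > 0"
    and ij: "real (i + j) + 2 / p < real k"
    and u: "locally_integrable u"
    and v: "\<And>i j. i + j \<le> k \<Longrightarrow> is_weak_deriv (i, j) u (v i j)"
      "\<And>i j. i + j \<le> k \<Longrightarrow> v i j \<in> borel_measurable borel"
      "\<And>i j. i + j \<le> k \<Longrightarrow> (\<integral>\<^sup>+y. ennreal (\<bar>v i j y\<bar> powr p) \<partial>lborel) \<le> ennreal (S powr p)"
  shows "\<bar>conv b u i j z\<bar> \<le> sobolev_const p * S"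
proof -
  have bound: "(\<integral>\<^sup>+w\<in>unit_square. ennreal \<bar>conv b u i j (z + t *\<^sub>R w)\<bar> \<partial>lborel) \<le> ennreal (2 * t powr (- 2 / p) * S)"
    if "i + j \<le> k" "t > 0" for i j t
    unfolding conv_weak_deriv[OF b v(1)[OF that(1)]]
    by (rule conv_square_bound[OF b v(2) p S that(2) v(3)]) (fact that)+
  have bound1: "(\<integral>\<^sup>+w\<in>unit_square. ennreal \<bar>conv b u i j (z + w)\<bar> \<partial>lborel) \<le> ennreal (2 * S)"
    if "i + j \<le> k" for i j
    using bound[OF that, of 1] by simp
  note [measurable] = continuous_on_conv[OF b u, THEN borel_measurable_continuous_onI]
  note der = has_derivative_conv[OF b u]
  have "ennreal \<bar>conv b u i j z\<bar> \<le> ennreal (sobolev_const p * S)"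
  proof (cases "p \<le> 2")
    case True
    then have "2 / p \<ge> 1" using p by simp
    \<comment> \<open>The strict inequality between integers turns 2/p >= 1 into two spare
      derivatives.\<close>
    then have "i + j + 2 \<le> k" using ij by linarith
    then have k: "i + j \<le> k" "Suc i + j \<le> k" "i + Suc j \<le> k" "Suc i + Suc j \<le> k" by auto
    have "ennreal \<bar>conv b u i j z\<bar> \<le> (\<integral>\<^sup>+w\<in>unit_square. (ennreal \<bar>conv b u i j (z + w)\<bar> + ennreal \<bar>conv b u (Suc i) j (z + w)\<bar> +
        ennreal \<bar>conv b u i (Suc j) (z + w)\<bar> + ennreal \<bar>conv b u (Suc i) (Suc j) (z + w)\<bar>) \<partial>lborel)"
      by (rule abs_le_square_mixed[OF der der]) (intro continuous_on_conv[OF b u])+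
    also have "\<dots> = (\<integral>\<^sup>+w\<in>unit_square. ennreal \<bar>conv b u i j (z + w)\<bar> \<partial>lborel) +
      (\<integral>\<^sup>+w\<in>unit_square. ennreal \<bar>conv b u (Suc i) j (z + w)\<bar> \<partial>lborel) +
      (\<integral>\<^sup>+w\<in>unit_square. ennreal \<bar>conv b u i (Suc j) (z + w)\<bar> \<partial>lborel) +
      (\<integral>\<^sup>+w\<in>unit_square. ennreal \<bar>conv b u (Suc i) (Suc j) (z + w)\<bar> \<partial>lborel)"
      by (simp add: distrib_right nn_integral_add)
    also have "\<dots> \<le> ennreal (2 * S) + ennreal (2 * S) + ennreal (2 * S) + ennreal (2 * S)"
      by (intro add_mono bound1 k)
    also have "\<dots> = ennreal (sobolev_const p * S)"
      using True S by (simp add: sobolev_const_def ennreal_plus[symmetric] del: ennreal_plus)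
    finally show ?thesis .
  next
    case False
    then have p2: "2 / p < 1" "2 / p > 0" by (auto simp: field_simps)
    \<comment> \<open>Here 2/p is only known to be positive, which leaves one spare
      derivative.\<close>
    then have "i + j + 1 \<le> k" using ij by linarith
    then have k: "i + j \<le> k" "Suc i + j \<le> k" "i + Suc j \<le> k" by auto
    have "ennreal \<bar>conv b u i j z\<bar> \<le> (\<integral>\<^sup>+w\<in>unit_square. ennreal \<bar>conv b u i j (z + w)\<bar> \<partial>lborel) +
      (\<integral>\<^sup>+t\<in>{0..1}. (\<integral>\<^sup>+w\<in>unit_square. (ennreal \<bar>conv b u (Suc i) j (z + t *\<^sub>R w)\<bar> + ennreal \<bar>conv b u i (Suc j) (z + t *\<^sub>R w)\<bar>) \<partial>lborel) \<partial>lborel)"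
      by (rule abs_le_square_radial[OF der]) (intro continuous_on_conv[OF b u])+
    also have "\<dots> \<le> ennreal (2 * S) + (\<integral>\<^sup>+t. ennreal (4 * S) * (ennreal (t powr (- 2 / p)) * indicator {0..1} t) \<partial>lborel)"
    proof (intro add_mono bound1 k nn_integral_mono_AE)
      \<comment> \<open>The point t = 0 is discarded: the scaled average is bounded only for t > 0,
        and \<open>0 powr (- 2 / p)\<close> is 0, so the inequality could fail there.\<close>
      show "AE t in lborel. (\<integral>\<^sup>+w\<in>unit_square. (ennreal \<bar>conv b u (Suc i) j (z + t *\<^sub>R w)\<bar> + ennreal \<bar>conv b u i (Suc j) (z + t *\<^sub>R w)\<bar>) \<partial>lborel) * indicator {0..1} t
        \<le> ennreal (4 * S) * (ennreal (t powr (- 2 / p)) * indicator {0..1} t)"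
        using AE_lborel_singleton[of "0::real"]
      proof eventually_elim
        fix t :: real assume t: "t \<noteq> 0"
        show "(\<integral>\<^sup>+w\<in>unit_square. (ennreal \<bar>conv b u (Suc i) j (z + t *\<^sub>R w)\<bar> + ennreal \<bar>conv b u i (Suc j) (z + t *\<^sub>R w)\<bar>) \<partial>lborel) * indicator {0..1} t
        \<le> ennreal (4 * S) * (ennreal (t powr (- 2 / p)) * indicator {0..1} t)"
        proof (cases "t \<in> {0..1}")
          case True
          then have t: "t > 0" using t by simp
          have "(\<integral>\<^sup>+w\<in>unit_square. (ennreal \<bar>conv b u (Suc i) j (z + t *\<^sub>R w)\<bar> + ennreal \<bar>conv b u i (Suc j) (z + t *\<^sub>R w)\<bar>) \<partial>lborel)
            = (\<integral>\<^sup>+w\<in>unit_square. ennreal \<bar>conv b u (Suc i) j (z + t *\<^sub>R w)\<bar> \<partial>lborel) +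
              (\<integral>\<^sup>+w\<in>unit_square. ennreal \<bar>conv b u i (Suc j) (z + t *\<^sub>R w)\<bar> \<partial>lborel)"
            by (simp add: distrib_right nn_integral_add)
          also have "\<dots> \<le> ennreal (2 * t powr (- 2 / p) * S) + ennreal (2 * t powr (- 2 / p) * S)"
            by (intro add_mono bound k t)
          also have "\<dots> = ennreal (4 * S) * ennreal (t powr (- 2 / p))"
            using S by (simp add: ennreal_plus[symmetric] ennreal_mult[symmetric] del: ennreal_plus)
          finally show ?thesis using True by simp
        qed simp
      qed
    qed
    also have "(\<integral>\<^sup>+t. ennreal (4 * S) * (ennreal (t powr (- 2 / p)) * indicator {0..1} t) \<partial>lborel)
        = ennreal (4 * S) * ennreal (1 / (- 2 / p + 1))"
      using p2 by (subst nn_integral_cmult) (auto simp: nn_integral_powr_unit_interval)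
    also have "ennreal (2 * S) + ennreal (4 * S) * ennreal (1 / (- 2 / p + 1)) = ennreal (sobolev_const p * S)"
      using False S p2 by (simp add: sobolev_const_def ennreal_plus[symmetric] ennreal_mult[symmetric] algebra_simps del: ennreal_plus)
    finally show ?thesis .
  qed
  moreover have "sobolev_const p * S \<ge> 0"
    using S p by (auto simp: sobolev_const_def divide_le_eq)
  ultimately show ?thesis by (simp add: ennreal_le_iff)
qed

section \<open>Commuting mollifications and approximation of Lipschitz functions\<close>

lemma lborel_eq_reflect: "lborel = distr lborel borel (\<lambda>x. (z :: 'a::euclidean_space) - x)"
  using lborel_affine[of "-1" z] by (simp add: density_1)

lemma integral_lborel_reflect:
  fixes f :: "'a::euclidean_space \<Rightarrow> real"
  assumes "f \<in> borel_measurable borel"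
  shows "(\<integral>x. f (z - x) \<partial>lborel) = (\<integral>x. f x \<partial>lborel)"
  by (subst (2) lborel_eq_reflect[of z], subst integral_distr) (use assms in auto)

text \<open>As v is only locally integrable, domination is by the product of |v| cut off to K and M
  times the indicator of the closure of L. The set L is merely bounded because it is later taken to
  be an open set.\<close>

lemma Fubini_compact_support:
  fixes v :: "plane \<Rightarrow> real" and G :: "plane \<Rightarrow> plane \<Rightarrow> real"
  assumes v: "v \<in> borel_measurable borel" "locally_integrable v"
    and G: "case_prod G \<in> borel_measurable (borel \<Otimes>\<^sub>M borel)"
    and K: "compact K" "bounded L"
    and M: "\<And>x y. \<bar>G x y\<bar> \<le> M" and G0: "\<And>x y. x \<notin> K \<or> y \<notin> L \<Longrightarrow> G x y = 0"
  shows "(\<integral>y. (\<integral>x. v x * G x y \<partial>lborel) \<partial>lborel) = (\<integral>x. (\<integral>y. v x * G x y \<partial>lborel) \<partial>lborel)"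
proof (rule lborel_pair.Fubini_integral)
  note [measurable] = v(1)
  have [measurable]: "(\<lambda>x. case_prod G x) \<in> borel_measurable (borel \<Otimes>\<^sub>M borel)" using G by simp
  define L' where "L' = closure L"
  have L': "compact L'" "L \<subseteq> L'" using K(2) by (auto simp: L'_def closure_subset compact_closure)
  have [measurable]: "K \<in> sets borel" "L' \<in> sets borel" using K(1) L' by (auto simp: borel_compact)
  have fin: "emeasure lborel L' < \<infinity>" using L'(1) by (intro emeasure_bounded_finite compact_imp_bounded)
  have vK: "integrable lborel (\<lambda>x. indicator K x *\<^sub>R v x)"
    using v(2) K(1) by (simp add: locally_integrable_def set_integrable_def)
  have M0: "M \<ge> 0" using M[of undefined undefined] by linarith
  have ind: "integrable lborel (indicat_real L')"
    using fin by simp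
  have "integrable (lborel \<Otimes>\<^sub>M lborel) (\<lambda>(x, y). \<bar>indicator K x *\<^sub>R v x\<bar> * (M * indicator L' y))"
  proof (rule lborel_pair.Fubini_integrable)
    have "integrable lborel (\<lambda>x. \<bar>indicator K x *\<^sub>R v x\<bar> * (\<integral>y. M * indicator L' y \<partial>lborel))"
      using vK by (intro integrable_mult_left integrable_abs)
    then show "integrable lborel (\<lambda>x. \<integral>y. norm (case (x, y) of (x, y) \<Rightarrow> \<bar>indicator K x *\<^sub>R v x\<bar> * (M * indicator L' y)) \<partial>lborel)"
      using M0 by (simp add: abs_mult)
    show "AE x in lborel. integrable lborel (\<lambda>y. case (x, y) of (x, y) \<Rightarrow> \<bar>indicator K x *\<^sub>R v x\<bar> * (M * indicator L' y))"
      using ind by auto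
  qed simp
  then show "integrable (lborel \<Otimes>\<^sub>M lborel) (\<lambda>(x, y). v x * G x y)"
  proof (rule Bochner_Integration.integrable_bound)
    have "(\<lambda>z. v (fst z) * case_prod G z) \<in> borel_measurable (borel \<Otimes>\<^sub>M borel)" by measurable
    then show "(\<lambda>(x, y). v x * G x y) \<in> borel_measurable (lborel \<Otimes>\<^sub>M lborel)"
      by (simp add: case_prod_beta cong: measurable_cong_sets)
    have "\<bar>v x * G x y\<bar> \<le> \<bar>indicator K x *\<^sub>R v x\<bar> * (M * indicator L' y)" for x y
    proof (cases "x \<in> K \<and> y \<in> L'")
      case True
      then show ?thesis using M[of x y] by (simp add: abs_mult mult_left_mono)
    next
      case False
      then have "G x y = 0" using L'(2) by (intro G0) auto
      then show ?thesis using M0 by simp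
    qed
    then show "AE z in lborel \<Otimes>\<^sub>M lborel. norm (case z of (x, y) \<Rightarrow> v x * G x y)
        \<le> norm (case z of (x, y) \<Rightarrow> \<bar>indicator K x *\<^sub>R v x\<bar> * (M * indicator L' y))"
      using M0 by (auto simp: abs_mult)
  qed
qed

lemma kern_bounded:
  assumes "mollifier e b"
  shows "\<exists>K\<ge>0. \<forall>z. \<bar>kern b i j z\<bar> \<le> K"
proof -
  obtain K where K: "K \<ge> 0" "\<And>t. \<bar>b i t\<bar> \<le> K" using mollifier_bounded[OF assms] by blast
  obtain L where L: "L \<ge> 0" "\<And>t. \<bar>b j t\<bar> \<le> L" using mollifier_bounded[OF assms] by blast
  have "\<bar>kern b i j z\<bar> \<le> K * L" for z
    unfolding kern_def abs_mult using K L by (intro mult_mono) auto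
  then show ?thesis using K(1) L(1) by (intro exI[of _ "K * L"]) auto
qed

lemma conv_conv:
  assumes b: "mollifier e b" and b': "mollifier e' b'"
    and v: "v \<in> borel_measurable borel" "locally_integrable v"
  shows "conv b (conv b' v 0 0) 0 0 z = (\<integral>x. v x * (\<integral>y. kern b' 0 0 (y - x) * kern b 0 0 (z - y) \<partial>lborel) \<partial>lborel)"
proof -
  obtain M where M: "M \<ge> 0" "\<And>z. \<bar>kern b 0 0 z\<bar> \<le> M" using kern_bounded[OF b] by blast
  obtain M' where M': "M' \<ge> 0" "\<And>z. \<bar>kern b' 0 0 z\<bar> \<le> M'" using kern_bounded[OF b'] by blast
  note [measurable] = kern_measurable[OF b] kern_measurable[OF b']
  have "conv b (conv b' v 0 0) 0 0 z = (\<integral>y. (\<integral>x. v x * (kern b' 0 0 (y - x) * kern b 0 0 (z - y)) \<partial>lborel) \<partial>lborel)"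
    unfolding conv_def by (simp add: mult.assoc[symmetric] del: integral_mult_left_zero flip: integral_mult_left_zero)
  also have "\<dots> = (\<integral>x. (\<integral>y. v x * (kern b' 0 0 (y - x) * kern b 0 0 (z - y)) \<partial>lborel) \<partial>lborel)"
  proof (rule Fubini_compact_support[OF v])
    show "(\<lambda>(x, y). kern b' 0 0 (y - x) * kern b 0 0 (z - y)) \<in> borel_measurable (borel \<Otimes>\<^sub>M borel)"
      by measurable
    show "\<bar>kern b' 0 0 (y - x) * kern b 0 0 (z - y)\<bar> \<le> M' * M" for x y
      unfolding abs_mult using M M' by (intro mult_mono) auto
    show "kern b' 0 0 (y - x) * kern b 0 0 (z - y) = 0"
      if "x \<notin> cball z (2 * e + 2 * e') \<or> y \<notin> cball z (2 * e)" for x y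
    proof (rule ccontr)
      assume "kern b' 0 0 (y - x) * kern b 0 0 (z - y) \<noteq> 0"
      then have "norm (y - x) \<le> 2 * e'" "norm (z - y) \<le> 2 * e"
        using kern_zero[OF b', of "y - x" 0 0] kern_zero[OF b, of "z - y" 0 0] by (auto simp: not_less[symmetric])
      then show False
        using that norm_triangle_ineq[of "z - y" "y - x"] by (auto simp: dist_norm)
    qed
  qed auto
  finally show ?thesis by simp
qed

text \<open>In the formula of \<open>conv_conv\<close>, the reflection y -> z + x - y exchanges the
  arguments of the two kernels.\<close>

lemma conv_commute:
  assumes b: "mollifier e b" and b': "mollifier e' b'"
    and v: "v \<in> borel_measurable borel" "locally_integrable v"
  shows "conv b (conv b' v 0 0) 0 0 z = conv b' (conv b v 0 0) 0 0 z"
proof -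
  note [measurable] = kern_measurable[OF b] kern_measurable[OF b']
  have "(\<integral>y. kern b' 0 0 (y - x) * kern b 0 0 (z - y) \<partial>lborel) = (\<integral>y. kern b 0 0 (y - x) * kern b' 0 0 (z - y) \<partial>lborel)" for x
  proof -
    have "(\<integral>y. kern b' 0 0 (y - x) * kern b 0 0 (z - y) \<partial>lborel)
        = (\<integral>y. kern b' 0 0 ((z + x - y) - x) * kern b 0 0 (z - (z + x - y)) \<partial>lborel)"
      by (rule integral_lborel_reflect[symmetric]) measurable
    then show ?thesis by (simp add: algebra_simps)
  qed
  then show ?thesis by (simp add: conv_conv[OF b b' v] conv_conv[OF b' b v])
qed

lemma kern_integral:
  assumes b: "mollifier e b"
  shows "integrable lborel (\<lambda>y. kern b 0 0 (z - y))" and "(\<integral>y. kern b 0 0 (z - y) \<partial>lborel) = 1"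
    and "(\<integral>y. kern b 0 0 (y - z) \<partial>lborel) = 1"
proof -
  note [measurable] = kern_measurable[OF b]
  have 1: "(\<integral>\<^sup>+y. ennreal (kern b 0 0 (z - y)) \<partial>lborel) = 1"
    using nn_integral_lborel_reflect[of "\<lambda>y. ennreal (kern b 0 0 y)" z] nn_integral_kern[OF b] by simp
  show i: "integrable lborel (\<lambda>y. kern b 0 0 (z - y))"
    by (rule integrableI_nonneg) (use 1 in \<open>auto simp: kern_nonneg[OF b]\<close>)
  show int: "(\<integral>y. kern b 0 0 (z - y) \<partial>lborel) = 1" for z
    by (subst integral_eq_nn_integral)
      (use nn_integral_lborel_reflect[of "\<lambda>y. ennreal (kern b 0 0 y)" z] nn_integral_kern[OF b] in \<open>auto simp: kern_nonneg[OF b]\<close>)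
  have "(\<integral>y. kern b 0 0 (y - z) \<partial>lborel) = (\<integral>y. kern b 0 0 ((z + z - y) - z) \<partial>lborel)"
    by (rule integral_lborel_reflect[symmetric]) measurable
  then show "(\<integral>y. kern b 0 0 (y - z) \<partial>lborel) = 1"
    using int[of z] by simp
qed

lemma locally_integrable_continuous:
  "continuous_on UNIV f \<Longrightarrow> locally_integrable f"
  unfolding locally_integrable_def set_integrable_def
  by (intro allI impI borel_integrable_compact) (auto intro: continuous_on_subset)

text \<open>The kernel is a probability density, so the error is an average of f(y) - f(z) over
  points y at distance at most 2 e from z. The explicit rate drives all later convergence
  statements.\<close>

lemma conv_lipschitz_approx:
  assumes b: "mollifier e b" and e: "e > 0"
    and f: "\<And>x y. \<bar>f x - f y\<bar> \<le> L * norm (x - y)" and L: "L \<ge> 0" and cf: "continuous_on UNIV f"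
  shows "\<bar>conv b f 0 0 z - f z\<bar> \<le> 2 * L * e"
proof -
  note int = conv_integrable[OF b locally_integrable_continuous[OF cf], of 0 0 z]
  note k = kern_integral[OF b]
  have "conv b f 0 0 z - f z = (\<integral>y. f y * kern b 0 0 (z - y) \<partial>lborel) - (\<integral>y. f z * kern b 0 0 (z - y) \<partial>lborel)"
    by (simp add: conv_def k)
  also have "\<dots> = (\<integral>y. f y * kern b 0 0 (z - y) - f z * kern b 0 0 (z - y) \<partial>lborel)"
    using int k(1) by (intro Bochner_Integration.integral_diff[symmetric]) auto
  also have "\<bar>\<dots>\<bar> \<le> (\<integral>y. 2 * L * e * kern b 0 0 (z - y) \<partial>lborel)"
  proof (rule integral_abs_bound_integral)
    fix y
    show "\<bar>f y * kern b 0 0 (z - y) - f z * kern b 0 0 (z - y)\<bar> \<le> 2 * L * e * kern b 0 0 (z - y)"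
    proof (cases "norm (z - y) > 2 * e")
      case False
      have "\<bar>f y - f z\<bar> \<le> L * norm (y - z)" by (rule f)
      also have "\<dots> \<le> L * (2 * e)" using False L by (intro mult_left_mono) (auto simp: norm_minus_commute)
      finally have "\<bar>f y - f z\<bar> * kern b 0 0 (z - y) \<le> L * (2 * e) * kern b 0 0 (z - y)"
        by (intro mult_right_mono kern_nonneg[OF b])
      then show ?thesis
        by (simp add: left_diff_distrib[symmetric] abs_mult kern_nonneg[OF b] mult_ac)
    qed (simp add: kern_zero[OF b])
  qed (use int k(1) in auto)
  also have "\<dots> = 2 * L * e" by (simp add: k)
  finally show ?thesis .
qed

lemma conv_lipschitz:
  assumes b: "mollifier e b" and u: "locally_integrable u"
    and B: "\<And>z. \<bar>conv b u (Suc i) j z\<bar> \<le> B" "\<And>z. \<bar>conv b u i (Suc j) z\<bar> \<le> B"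
  shows "\<bar>conv b u i j x - conv b u i j y\<bar> \<le> 2 * B * norm (x - y)"
proof -
  have "norm (conv b u i j x - conv b u i j y) \<le> 2 * B * norm (x - y)"
  proof (rule differentiable_bound[of UNIV])
    fix z :: plane
    show "(conv b u i j has_derivative (\<lambda>h. fst h * conv b u (Suc i) j z + snd h * conv b u i (Suc j) z)) (at z within UNIV)"
      using has_derivative_conv[OF b u] by simp
    show "onorm (\<lambda>h. fst h * conv b u (Suc i) j z + snd h * conv b u i (Suc j) z) \<le> 2 * B"
    proof (rule onorm_le)
      fix h :: plane
      have "\<bar>fst h * conv b u (Suc i) j z\<bar> \<le> norm h * B" "\<bar>snd h * conv b u i (Suc j) z\<bar> \<le> norm h * B"
        unfolding abs_mult using B[of z] by (intro mult_mono abs_fst_le_norm abs_snd_le_norm; simp)+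
      then show "norm (fst h * conv b u (Suc i) j z + snd h * conv b u i (Suc j) z) \<le> 2 * B * norm h"
        unfolding real_norm_def by (intro order_trans[OF abs_triangle_ineq]) (simp add: mult_ac)
    qed
  qed auto
  then show ?thesis by simp
qed

section \<open>Functions with small mollifications\<close>

text \<open>By Fubini the kernel moves from h to the indicator of B, giving the smoothed indicator
  \<open>X n\<close>. One side is at most C e |B| and tends to 0; on the other, \<open>X n\<close>
  tends to the indicator off the frontier and is dominated on a fixed ball, so the limit is the
  integral of h over B.\<close>

lemma set_integral_zero_of_conv_small:
  fixes h :: "plane \<Rightarrow> real"
  assumes h: "h \<in> borel_measurable borel" "locally_integrable h"
    and small: "\<And>e. 0 < e \<Longrightarrow> e < 1 \<Longrightarrow> \<exists>b. mollifier e b \<and> (\<forall>z. \<bar>conv b h 0 0 z\<bar> \<le> C * e)"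
    and B: "open B" "bounded B" "frontier B \<in> null_sets lborel"
  shows "(\<integral>y. h y * indicator B y \<partial>lborel) = 0"
proof -
  define e where "e n = 1 / (real n + 2)" for n
  have e: "0 < e n" "e n < 1" for n by (simp_all add: e_def)
  have e0: "e \<longlonglongrightarrow> 0"
    using LIMSEQ_ignore_initial_segment[OF lim_1_over_n, of 2] by (simp add: e_def[abs_def] add_ac)
  obtain b where b: "\<And>n. mollifier (e n) (b n)" "\<And>n z. \<bar>conv (b n) h 0 0 z\<bar> \<le> C * e n"
    using small[OF e] by metis
  note [measurable] = h(1) kern_measurable[OF b(1)]
  have [measurable]: "B \<in> sets borel" using B by simp
  define X where "X n y = (\<integral>z. kern (b n) 0 0 (z - y) * indicator B z \<partial>lborel)" for n y
  have C: "C \<ge> 0"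
    using b(2)[of 0 0] e(1)[of 0] by (smt (verit) mult_neg_pos abs_ge_zero)
  have finB: "integrable lborel (indicat_real B)"
    using emeasure_bounded_finite[OF B(2)] by simp
  have ki: "integrable lborel (\<lambda>z. kern (b n) 0 0 (z - y))" for n y
    using kern_integral(3)[OF b(1), of n y] not_integrable_integral_eq by fastforce
  have kB: "integrable lborel (\<lambda>z. kern (b n) 0 0 (z - y) * indicator B z)" for n y
    by (rule Bochner_Integration.integrable_bound[OF ki[of n y]]) (auto simp: indicator_def)
  have chi: "0 \<le> X n y" "X n y \<le> 1" for n y
  proof -
    show "0 \<le> X n y"
      unfolding X_def by (intro integral_nonneg_AE) (auto simp: kern_nonneg[OF b(1)])
    have "X n y \<le> (\<integral>z. kern (b n) 0 0 (z - y) \<partial>lborel)"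
      unfolding X_def by (intro integral_mono kB ki) (auto simp: indicator_def kern_nonneg[OF b(1)])
    then show "X n y \<le> 1" using kern_integral(3)[OF b(1)] by simp
  qed
  have chi0: "X n y = 0" if "\<And>z. z \<in> B \<Longrightarrow> norm (z - y) > 2 * e n" for n y
  proof -
    have "X n y = (\<integral>z. 0 \<partial>(lborel :: plane measure))"
      unfolding X_def
      by (rule Bochner_Integration.integral_cong) (auto simp: indicator_def kern_zero[OF b(1)] that)
    then show ?thesis by simp
  qed
  have chi1: "X n y = 1" if "\<And>z. norm (z - y) \<le> 2 * e n \<Longrightarrow> z \<in> B" for n y
  proof -
    have "X n y = (\<integral>z. kern (b n) 0 0 (z - y) \<partial>lborel)"
      unfolding X_def
    proof (rule Bochner_Integration.integral_cong)
      fix z show "kern (b n) 0 0 (z - y) * indicator B z = kern (b n) 0 0 (z - y)"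
        using that[of z] kern_zero[OF b(1), of n "z - y" 0 0] by (cases "norm (z - y) \<le> 2 * e n") auto
    qed simp
    then show ?thesis using kern_integral(3)[OF b(1)] by simp
  qed
  obtain m where m: "\<And>z. z \<in> B \<Longrightarrow> norm z \<le> m"
    using B(2) by (auto simp: bounded_iff)
  \<comment> \<open>All radii \<open>e n\<close> are below 1, so a collar of width 2 around B
    contains the supports of all \<open>X n\<close>.\<close>
  define K where "K = cball (0::plane) (m + 2)"
  have chiK: "X n y = 0" if "y \<notin> K" for n y
  proof (rule chi0)
    fix z assume "z \<in> B"
    then show "norm (z - y) > 2 * e n"
      using m[of z] that norm_triangle_ineq2[of y z] e(2)[of n] by (auto simp: K_def norm_minus_commute)
  qed
  have swap: "(\<integral>z. conv (b n) h 0 0 z * indicator B z \<partial>lborel) = (\<integral>y. h y * X n y \<partial>lborel)" for n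
  proof -
    obtain M where M: "M \<ge> 0" "\<And>z. \<bar>kern (b n) 0 0 z\<bar> \<le> M" using kern_bounded[OF b(1)] by blast
    have "(\<integral>z. conv (b n) h 0 0 z * indicator B z \<partial>lborel)
        = (\<integral>z. (\<integral>y. h y * (kern (b n) 0 0 (z - y) * indicator B z) \<partial>lborel) \<partial>lborel)"
      unfolding conv_def by (simp add: mult.assoc[symmetric] del: integral_mult_left_zero flip: integral_mult_left_zero)
    also have "\<dots> = (\<integral>y. (\<integral>z. h y * (kern (b n) 0 0 (z - y) * indicator B z) \<partial>lborel) \<partial>lborel)"
    proof (rule Fubini_compact_support[OF h, of _ K B M])
      show "compact K" by (simp add: K_def)
      show "(\<lambda>(y, z). kern (b n) 0 0 (z - y) * indicator B z) \<in> borel_measurable (borel \<Otimes>\<^sub>M borel)"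
        by measurable
      show "\<bar>kern (b n) 0 0 (z - y) * indicator B z\<bar> \<le> M" for y z
        using M by (auto simp: indicator_def)
      show "kern (b n) 0 0 (z - y) * indicator B z = 0" if "y \<notin> K \<or> z \<notin> B" for y z
      proof (cases "z \<in> B")
        case True
        then have "norm (z - y) > 2 * e n"
          using m[of z] that norm_triangle_ineq2[of y z] e(2)[of n] by (auto simp: K_def norm_minus_commute)
        then show ?thesis by (simp add: kern_zero[OF b(1)])
      qed simp
    qed (fact B)
    finally show ?thesis by (simp add: X_def)
  qed
  have "(\<lambda>n. \<integral>y. h y * X n y \<partial>lborel) \<longlonglongrightarrow> 0"
  proof (rule Lim_null_comparison)
    have "\<bar>\<integral>y. h y * X n y \<partial>lborel\<bar> \<le> C * e n * measure lborel B" for n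
    proof -
      have "\<bar>\<integral>z. conv (b n) h 0 0 z * indicator B z \<partial>lborel\<bar> \<le> (\<integral>z. C * e n * indicator B z \<partial>lborel)"
      proof (rule integral_abs_bound_integral)
        show "integrable lborel (\<lambda>z. C * e n * indicat_real B z)" using finB by simp
        then show "integrable lborel (\<lambda>z. conv (b n) h 0 0 z * indicator B z)"
        proof (rule Bochner_Integration.integrable_bound)
          have "conv (b n) h 0 0 \<in> borel_measurable borel"
            by (intro borel_measurable_continuous_onI continuous_on_conv[OF b(1) h(2)])
          then show "(\<lambda>z. conv (b n) h 0 0 z * indicator B z) \<in> borel_measurable lborel" by simp
          have "\<bar>conv (b n) h 0 0 z * indicator B z\<bar> \<le> \<bar>C * e n * indicator B z\<bar>" for z
            using b(2)[of n z] by (auto simp: indicator_def)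
          then show "AE z in lborel. norm (conv (b n) h 0 0 z * indicator B z) \<le> norm (C * e n * indicat_real B z)"
            by simp
        qed
      qed (use b(2) in \<open>auto simp: indicator_def\<close>)
      then show ?thesis by (simp add: swap)
    qed
    then show "\<forall>\<^sub>F n in sequentially. norm (\<integral>y. h y * X n y \<partial>lborel) \<le> C * e n * measure lborel B"
      by simp
    have "(\<lambda>n. C * e n * measure lborel B) \<longlonglongrightarrow> C * 0 * measure lborel B"
      by (intro tendsto_intros e0)
    then show "(\<lambda>n. C * e n * measure lborel B) \<longlonglongrightarrow> 0" by simp
  qed
  moreover have "(\<lambda>n. \<integral>y. h y * X n y \<partial>lborel) \<longlonglongrightarrow> (\<integral>y. h y * indicator B y \<partial>lborel)"
  proof (rule integral_dominated_convergence)
    have hK: "integrable lborel (\<lambda>y. indicator K y *\<^sub>R h y)"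
      using h(2) by (simp add: locally_integrable_def set_integrable_def K_def)
    then show "integrable lborel (\<lambda>y. \<bar>indicator K y *\<^sub>R h y\<bar>)" by (rule integrable_abs)
    show "(\<lambda>y. h y * X n y) \<in> borel_measurable lborel" for n
      unfolding X_def by measurable
    have "\<bar>h y * X n y\<bar> \<le> \<bar>indicator K y *\<^sub>R h y\<bar>" for n y
    proof (cases "y \<in> K")
      case True
      then show ?thesis using chi[of n y] by (simp add: abs_mult mult_right_le_one_le)
    qed (simp add: chiK)
    then show "AE y in lborel. norm (h y * X n y) \<le> \<bar>indicator K y *\<^sub>R h y\<bar>" for n by simp
    have "AE y in lborel. y \<notin> frontier B"
      using B(3) by (rule AE_not_in)
    then show "AE y in lborel. (\<lambda>n. h y * X n y) \<longlonglongrightarrow> h y * indicator B y"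
    proof eventually_elim
      fix y assume y: "y \<notin> frontier B"
      have "\<exists>d>0. \<forall>n. 2 * e n < d \<longrightarrow> X n y = indicator B y"
      proof (cases "y \<in> B")
        case True
        then obtain d where d: "d > 0" "ball y d \<subseteq> B" using B(1) open_contains_ball by blast
        have "X n y = indicator B y" if "2 * e n < d" for n
          using True that d(2) by (subst chi1) (auto simp: dist_norm norm_minus_commute subset_eq)
        then show ?thesis using d(1) by blast
      next
        case False
        then have "y \<in> - closure B" using y B(1) by (simp add: frontier_def interior_open)
        then obtain d where d: "d > 0" "ball y d \<subseteq> - closure B"
          using open_contains_ball[of "- closure B"] by auto
        have "X n y = indicator B y" if n: "2 * e n < d" for n
        proof (subst chi0)
          fix z assume "z \<in> B"
          then have "z \<notin> ball y d" using d(2) closure_subset by blast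
          then show "norm (z - y) > 2 * e n" using n by (simp add: dist_norm norm_minus_commute)
        qed (use False in simp)
        then show ?thesis using d(1) by blast
      qed
      then obtain d where d: "d > 0" "\<And>n. 2 * e n < d \<Longrightarrow> X n y = indicator B y" by blast
      have "\<forall>\<^sub>F n in sequentially. e n < d / 2"
        using e0 d(1) by (intro order_tendstoD(2)[OF e0]) auto
      then have "\<forall>\<^sub>F n in sequentially. h y * X n y = h y * indicator B y"
        by eventually_elim (simp add: d(2))
      then show "(\<lambda>n. h y * X n y) \<longlonglongrightarrow> h y * indicator B y"
        by (rule tendsto_eventually)
    qed
  qed simp
  ultimately show ?thesis
    using LIMSEQ_unique by blast
qed

lemma box_frontier_null: "frontier (box a b :: 'a::euclidean_space set) \<in> null_sets lborel"
proof -
  have "frontier (box a b) \<subseteq> cbox a b - box a b"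
    using closure_minimal[OF box_subset_cbox closed_cbox, of a b] open_box[of a b]
    by (auto simp: frontier_def interior_open)
  then have "negligible (frontier (box a b))"
    using negligible_frontier_interval negligible_subset by blast
  then have "frontier (box a b) \<in> null_sets (completion lborel)"
    by (simp add: negligible_iff_null_sets)
  then show ?thesis
    by (subst (asm) null_sets_completion_iff) auto
qed

text \<open>Boxes are stable under intersection and generate the Borel sets. So the cut-off of h to
  a box, whose integral over every box is 0, has integral 0 over every Borel set and vanishes almost
  everywhere.\<close>

lemma AE_zero_of_box_integrals:
  fixes h :: "'a::euclidean_space \<Rightarrow> real"
  assumes h: "h \<in> borel_measurable borel" "\<And>a b. integrable lborel (\<lambda>y. h y * indicator (box a b) y)"
    and 0: "\<And>a b. (\<integral>y. h y * indicator (box a b) y \<partial>lborel) = 0"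
  shows "AE y in lborel. h y = 0"
proof -
  have "AE y in lborel. h y * indicator (box a b) y = 0" for a b
  proof -
    let ?g = "\<lambda>y. h y * indicator (box a b) y"
    let ?E = "range (\<lambda>(a, b). box a b :: 'a set)"
    have gi: "integrable lborel ?g" by (rule h(2))
    have gA: "integrable lborel (\<lambda>y. indicator A y *\<^sub>R ?g y)" if "A \<in> sets borel" for A
      using gi that by (intro integrable_mult_indicator) auto
    have int: "(LINT y:A|lborel. ?g y) = 0" if "A \<in> sets borel" for A
    proof -
      have "Int_stable ?E" by (auto simp: Int_stable_def box_Int_box)
      moreover have "?E \<subseteq> Pow UNIV" by simp
      moreover have "A \<in> sigma_sets UNIV ?E" using that by (subst (asm) borel_eq_box) simp
      ultimately show ?thesis
      proof (induction rule: sigma_sets_induct_disjoint)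
        fix A assume "A \<in> ?E"
        then obtain c d where A: "A = box c d" by auto
        obtain x y :: 'a where "box c d \<inter> box a b = box x y" by (rule that[OF box_Int_box])
        then have "(LINT y:A|lborel. ?g y) = (\<integral>z. h z * indicator (box x y) z \<partial>lborel)"
          unfolding set_lebesgue_integral_def A
          by (intro Bochner_Integration.integral_cong) (auto simp: indicator_def fun_eq_iff)
        then show "(LINT y:A|lborel. ?g y) = 0" by (simp add: 0)
      next
        show "(LINT y:{}|lborel. ?g y) = 0" by (simp add: set_lebesgue_integral_def)
      next
        fix A assume A: "A \<in> sigma_sets UNIV ?E" and IH: "(LINT y:A|lborel. ?g y) = 0"
        have Ab: "A \<in> sets borel" using A by (subst borel_eq_box) simp
        have "(\<integral>y. indicator A y *\<^sub>R ?g y \<partial>lborel) + (\<integral>y. indicator (UNIV - A) y *\<^sub>R ?g y \<partial>lborel)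
           = (\<integral>y. indicator A y *\<^sub>R ?g y + indicator (UNIV - A) y *\<^sub>R ?g y \<partial>lborel)"
          using Ab by (intro Bochner_Integration.integral_add[symmetric] gA) auto
        also have "\<dots> = (\<integral>y. ?g y \<partial>lborel)"
          by (intro Bochner_Integration.integral_cong) (auto simp: indicator_def)
        finally show "(LINT y:UNIV - A|lborel. ?g y) = 0"
          using IH 0 by (simp add: set_lebesgue_integral_def)
      next
        fix A :: "nat \<Rightarrow> 'a set"
        assume dis: "disjoint_family A" and A: "range A \<subseteq> sigma_sets UNIV ?E"
          and IH: "\<And>i. (LINT y:A i|lborel. ?g y) = 0"
        have Ab: "A i \<in> sets borel" for i using A by (subst borel_eq_box) auto
        have "(LINT y:(\<Union>i. A i)|lborel. ?g y) = (\<Sum>i. (LINT y:A i|lborel. ?g y))"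
        proof (rule lebesgue_integral_countable_add)
          show "set_integrable lborel (\<Union>i. A i) ?g"
            unfolding set_integrable_def using Ab by (intro gA) auto
        qed (use Ab dis in \<open>auto simp: disjoint_family_on_def\<close>)
        then show "(LINT y:(\<Union>i. A i)|lborel. ?g y) = 0" by (simp add: IH)
      qed
    qed
    show ?thesis
      by (rule sigma_finite_measure.density_zero[OF lborel.sigma_finite_measure_axioms gi]) (simp add: int)
  qed
  \<comment> \<open>Integrability of h is known only on boxes; countably many boxes exhausting the
    space combine the local conclusions.\<close>
  then have "AE y in lborel. \<forall>n::nat. h y * indicator (box (- (real n *\<^sub>R One)) (real n *\<^sub>R One)) y = 0"
    unfolding AE_all_countable by blast
  then show ?thesis
  proof eventually_elim
    fix y assume y: "\<forall>n::nat. h y * indicator (box (- (real n *\<^sub>R One)) (real n *\<^sub>R One)) y = 0"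
    obtain n :: nat where "y \<in> box (- (real n *\<^sub>R One)) (real n *\<^sub>R One)"
      using UN_box_eq_UNIV by blast
    then show "h y = 0" using y[rule_format, of n] by simp
  qed
qed

lemma AE_zero_of_conv_small:
  fixes h :: "plane \<Rightarrow> real"
  assumes h: "h \<in> borel_measurable borel" "locally_integrable h"
    and small: "\<And>e. 0 < e \<Longrightarrow> e < 1 \<Longrightarrow> \<exists>b. mollifier e b \<and> (\<forall>z. \<bar>conv b h 0 0 z\<bar> \<le> C * e)"
  shows "AE y in lborel. h y = 0"
proof (rule AE_zero_of_box_integrals[OF h(1)])
  fix a b :: plane
  show "(\<integral>y. h y * indicator (box a b) y \<partial>lborel) = 0"
    by (rule set_integral_zero_of_conv_small[OF h small]) (auto simp: box_frontier_null bounded_box)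
  have "set_integrable lborel (box a b) h"
    by (rule set_integrable_subset[of _ "cbox a b"])
      (use h(2) box_subset_cbox in \<open>auto simp: locally_integrable_def\<close>)
  then show "integrable lborel (\<lambda>y. h y * indicator (box a b) y)"
    by (simp add: set_integrable_def mult.commute)
qed

text \<open>Both candidates have the same mollifications, namely those of u with the derivative on
  the kernel, so their difference mollifies to 0 and \<open>AE_zero_of_conv_small\<close> applies
  with constant 0.\<close>

lemma weak_deriv_unique:
  assumes "is_weak_deriv (i, j) u v" "is_weak_deriv (i, j) u w"
    and m: "v \<in> borel_measurable borel" "w \<in> borel_measurable borel"
  shows "AE y in lborel. v y = w y"
proof -
  have li: "locally_integrable v" "locally_integrable w" using assms by (auto simp: is_weak_deriv_def)
  then have li': "locally_integrable (\<lambda>y. v y - w y)"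
    by (auto simp: locally_integrable_def intro!: set_integral_diff)
  have "AE y in lborel. v y - w y = 0"
  proof (rule AE_zero_of_conv_small[OF _ li'])
    fix e :: real assume "0 < e" "e < 1"
    then obtain b where b: "mollifier e b" using mollifier_exists by blast
    have "conv b (\<lambda>y. v y - w y) 0 0 z = conv b v 0 0 z - conv b w 0 0 z" for z
      unfolding conv_def left_diff_distrib
      by (intro Bochner_Integration.integral_diff conv_integrable[OF b] li)
    then have "conv b (\<lambda>y. v y - w y) 0 0 z = 0" for z
      using conv_weak_deriv[OF b assms(1)] conv_weak_deriv[OF b assms(2)] by simp
    then show "\<exists>b. mollifier e b \<and> (\<forall>z. \<bar>conv b (\<lambda>y. v y - w y) 0 0 z\<bar> \<le> 0 * e)"
      using b by auto
  qed (use m in simp)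
  then show ?thesis by simp
qed

lemma continuous_AE_eq:
  fixes f g :: "'a::euclidean_space \<Rightarrow> real"
  assumes "continuous_on UNIV f" "continuous_on UNIV g" "AE y in lborel. f y = g y"
  shows "f = g"
proof (rule ccontr)
  assume "f \<noteq> g"
  then obtain y where y: "f y \<noteq> g y" by auto
  let ?U = "{y. f y - g y \<noteq> 0}"
  have "?U = (\<lambda>y. f y - g y) -` (- {0})" by auto
  then have "open ?U"
    using assms(1,2) by (auto intro!: open_vimage continuous_on_diff)
  moreover have "y \<in> ?U" using y by simp
  ultimately obtain d where d: "d > 0" "ball y d \<subseteq> ?U" using open_contains_ball by blast
  have "AE x in lborel. x \<notin> ball y d" using assms(3) by eventually_elim (use d(2) in auto)
  then have "ball y d \<in> null_sets lborel"
    by (subst (asm) AE_iff_null_sets[symmetric]) auto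
  then have "ball y d \<in> null_sets (completion lborel)"
    by (rule null_sets_completionI)
  then have "negligible (ball y d)" by (simp add: negligible_iff_null_sets)
  then show False using d(1) open_not_negligible[of "ball y d"] by auto
qed

section \<open>Consistency of stencils for smooth functions\<close>

text \<open>Pascal's rule after an index shift; it carries the derivative of one Taylor term to the
  next.\<close>

lemma sum_binomial_step:
  fixes T :: "nat \<Rightarrow> nat \<Rightarrow> real"
  shows "(\<Sum>a\<le>m. real (m choose a) * (T (Suc a) (m - a) + T a (Suc (m - a))))
    = (\<Sum>a\<le>Suc m. real (Suc m choose a) * T a (Suc m - a))"
proof -
  have "(\<Sum>a\<le>Suc m. real (m choose a) * T a (Suc m - a))
      = (\<Sum>a\<le>m. real (m choose a) * T a (Suc (m - a)))"
    by (simp add: Suc_diff_le)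
  then have "(\<Sum>a\<le>m. real (m choose a) * T a (Suc (m - a)))
      = T 0 (Suc m) + (\<Sum>a\<le>m. real (m choose Suc a) * T (Suc a) (m - a))"
    by (simp only: sum.atMost_Suc_shift) simp
  moreover have "(\<Sum>a\<le>Suc m. real (Suc m choose a) * T a (Suc m - a))
      = T 0 (Suc m) + ((\<Sum>a\<le>m. real (m choose a) * T (Suc a) (m - a)) + (\<Sum>a\<le>m. real (m choose Suc a) * T (Suc a) (m - a)))"
    by (simp only: sum.atMost_Suc_shift) (simp add: sum.distrib distrib_right)
  ultimately show ?thesis
    by (simp add: sum.distrib distrib_left)
qed

text \<open>When \<open>U a b\<close> are the mixed derivatives of \<open>U 0 0\<close>, this is the
  m-th directional derivative of \<open>U 0 0\<close> along r at z, expanded binomially.\<close>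

definition taylor_term :: "(nat \<Rightarrow> nat \<Rightarrow> plane \<Rightarrow> real) \<Rightarrow> plane \<Rightarrow> nat \<Rightarrow> plane \<Rightarrow> real" where
  "taylor_term U r m z = (\<Sum>a\<le>m. real (m choose a) * (mpower r (a, m - a) * U a (m - a) z))"

text \<open>Restricted to the line t -> x + t r, the Taylor terms are successive derivatives in t,
  so the one-variable Maclaurin formula at t = 1 gives the expansion with a Lagrange
  remainder.\<close>

lemma taylor_expansion:
  fixes U :: "nat \<Rightarrow> nat \<Rightarrow> plane \<Rightarrow> real"
  assumes U: "\<And>i j z. (U i j has_derivative (\<lambda>h. fst h * U (Suc i) j z + snd h * U i (Suc j) z)) (at z)"
  shows "\<exists>z. U 0 0 (x + r) = (\<Sum>m<n. taylor_term U r m x / fact m) + taylor_term U r n z / fact n"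
proof -
  have "((\<lambda>t. taylor_term U r m (x + t *\<^sub>R r)) has_real_derivative taylor_term U r (Suc m) (x + t *\<^sub>R r)) (at t)" for m t
  proof -
    let ?z = "x + t *\<^sub>R r"
    have "((\<lambda>t. taylor_term U r m (x + t *\<^sub>R r)) has_real_derivative
      (\<Sum>a\<le>m. real (m choose a) * (mpower r (a, m - a) * (fst r * U (Suc a) (m - a) ?z + snd r * U a (Suc (m - a)) ?z)))) (at t)"
      unfolding taylor_term_def
      by (intro DERIV_sum DERIV_cmult has_derivative_imp_deriv_along U)
    also have "(\<Sum>a\<le>m. real (m choose a) * (mpower r (a, m - a) * (fst r * U (Suc a) (m - a) ?z + snd r * U a (Suc (m - a)) ?z)))
      = (\<Sum>a\<le>m. real (m choose a) * (mpower r (Suc a, m - a) * U (Suc a) (m - a) ?z + mpower r (a, Suc (m - a)) * U a (Suc (m - a)) ?z))"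
      by (intro sum.cong refl) (simp add: mpower_def algebra_simps)
    also have "\<dots> = taylor_term U r (Suc m) ?z"
      unfolding taylor_term_def by (rule sum_binomial_step[of m "\<lambda>a c. mpower r (a, c) * U a c ?z"])
    finally show ?thesis .
  qed
  then have "\<exists>t. \<bar>t\<bar> \<le> \<bar>1\<bar> \<and> taylor_term U r 0 (x + 1 *\<^sub>R r) =
      (\<Sum>m<n. (taylor_term U r m (x + 0 *\<^sub>R r) / fact m) * 1 ^ m) + (taylor_term U r n (x + t *\<^sub>R r) / fact n) * 1 ^ n"
    by (intro Maclaurin_all_le[of "\<lambda>m t. taylor_term U r m (x + t *\<^sub>R r)"]) auto
  then show ?thesis
    by (auto simp: taylor_term_def[of _ _ 0] mpower_def simp del: split_paired_Ex)
qed

lemma taylor_term_bound: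
  assumes "\<And>a. a \<le> m \<Longrightarrow> \<bar>U a (m - a) z\<bar> \<le> B"
  shows "\<bar>taylor_term U r m z\<bar> \<le> 2 ^ m * norm r ^ m * B"
proof -
  have B: "B \<ge> 0" using assms[of 0] by auto
  have "\<bar>taylor_term U r m z\<bar> \<le> (\<Sum>a\<le>m. \<bar>real (m choose a) * (mpower r (a, m - a) * U a (m - a) z)\<bar>)"
    unfolding taylor_term_def by (rule sum_abs)
  also have "\<dots> \<le> (\<Sum>a\<le>m. real (m choose a) * (norm r ^ m * B))"
  proof (rule sum_mono)
    fix a assume a: "a \<in> {..m}"
    have "\<bar>mpower r (a, m - a)\<bar> \<le> norm r ^ a * norm r ^ (m - a)"
      unfolding mpower_def abs_mult power_abs fst_conv snd_conv
      by (intro mult_mono power_mono abs_fst_le_norm abs_snd_le_norm) auto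
    also have "\<dots> = norm r ^ m" using a by (simp flip: power_add)
    finally have "\<bar>mpower r (a, m - a)\<bar> * \<bar>U a (m - a) z\<bar> \<le> norm r ^ m * B"
      using a by (intro mult_mono assms) auto
    then show "\<bar>real (m choose a) * (mpower r (a, m - a) * U a (m - a) z)\<bar> \<le> real (m choose a) * (norm r ^ m * B)"
      by (simp add: abs_mult mult_left_mono)
  qed
  also have "\<dots> = real (\<Sum>a\<le>m. m choose a) * (norm r ^ m * B)"
    by (simp add: sum_distrib_right)
  finally show ?thesis by (simp add: choose_row_sum mult.assoc)
qed

text \<open>A Taylor term is linear in the moments of its order, so the consistency conditions
  decide its stencil sum. The factor 2 for m = 2 later cancels against 2! in the expansion and
  leaves the Laplacian.\<close>

lemma stencil_taylor_sum:
  assumes n: "1 \<le> n" and c: "consistent_stencil n N x f i" and m: "m \<le> n + 1"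
  shows "(\<Sum>j = 1..N. f i j * taylor_term U (x j - x i) m z)
    = (if m = 2 then 2 * (U 2 0 z + U 0 2 z) else 0)"
proof -
  let ?M = "\<lambda>\<alpha>. \<Sum>j = 1..N. f i j * mpower (x j - x i) \<alpha>"
  have "(\<Sum>j = 1..N. f i j * taylor_term U (x j - x i) m z)
    = (\<Sum>j = 1..N. \<Sum>a\<le>m. real (m choose a) * (f i j * mpower (x j - x i) (a, m - a) * U a (m - a) z))"
    by (simp add: taylor_term_def sum_distrib_left mult_ac)
  also have "\<dots> = (\<Sum>a\<le>m. \<Sum>j = 1..N. real (m choose a) * (f i j * mpower (x j - x i) (a, m - a) * U a (m - a) z))"
    by (rule sum.swap)
  also have "\<dots> = (\<Sum>a\<le>m. real (m choose a) * (?M (a, m - a) * U a (m - a) z))"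
    by (simp add: sum_distrib_left sum_distrib_right)
  also have "\<dots> = (if m = 2 then 2 * (U 2 0 z + U 0 2 z) else 0)"
  proof (cases "m = 2")
    case True
    have "?M (0, 2) = 2" "?M (1, 1) = 0" "?M (2, 0) = 2"
      using c by (simp_all add: consistent_stencil_def mpower_def power2_eq_square)
    moreover have "{..2} = {0, 1, 2 :: nat}" by auto
    ultimately show ?thesis using True by (simp add: numeral_2_eq_2 del: One_nat_def) (simp add: numeral_2_eq_2)
  next
    case False
    have "?M (a, m - a) = 0" if "a \<le> m" for a
      using c m that False by (simp add: consistent_stencil_def)
    then show ?thesis using False by simp
  qed
  finally show ?thesis .
qed

lemma stencil_error:
  fixes U :: "nat \<Rightarrow> nat \<Rightarrow> plane \<Rightarrow> real"
  assumes n: "1 \<le> n" and c: "consistent_stencil n N x f i" and i: "i \<in> {1..N}"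
    and nb: "\<And>j. j \<in> {1..N} \<Longrightarrow> j \<notin> neighbourhood h r R N x i \<Longrightarrow> f i j = 0"
    and Rh: "0 \<le> R * h"
    and U: "\<And>i j z. (U i j has_derivative (\<lambda>h. fst h * U (Suc i) j z + snd h * U i (Suc j) z)) (at z)"
    and B: "\<And>a b z. a + b = n + 2 \<Longrightarrow> \<bar>U a b z\<bar> \<le> B"
  shows "\<bar>U 2 0 (x i) + U 0 2 (x i) - (\<Sum>j = 1..N. f i j * U 0 0 (x j))\<bar> \<le> 2 ^ (n + 4) * B * (R * h) ^ n"
proof -
  let ?r = "\<lambda>j. x j - x i"
  have B0: "B \<ge> 0" using B[of 0 "n + 2" 0] by simp
  have "\<forall>j. \<exists>z. U 0 0 (x i + ?r j) = (\<Sum>m<n + 2. taylor_term U (?r j) m (x i) / fact m)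
      + taylor_term U (?r j) (n + 2) z / fact (n + 2)"
    by (intro allI taylor_expansion U)
  from choice[OF this] obtain \<zeta> where \<zeta>: "\<And>j. U 0 0 (x i + ?r j) =
      (\<Sum>m<n + 2. taylor_term U (?r j) m (x i) / fact m) + taylor_term U (?r j) (n + 2) (\<zeta> j) / fact (n + 2)"
    by blast
  define \<rho> where "\<rho> j = taylor_term U (?r j) (n + 2) (\<zeta> j) / fact (n + 2)" for j
  have "(\<Sum>j = 1..N. f i j * U 0 0 (x j)) = (\<Sum>j = 1..N. (\<Sum>m<n + 2. f i j * taylor_term U (?r j) m (x i) / fact m) + f i j * \<rho> j)"
  proof (rule sum.cong)
    fix j
    have "U 0 0 (x j) = (\<Sum>m<n + 2. taylor_term U (?r j) m (x i) / fact m) + \<rho> j"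
      using \<zeta>[of j] by (simp add: \<rho>_def)
    then show "f i j * U 0 0 (x j) = (\<Sum>m<n + 2. f i j * taylor_term U (?r j) m (x i) / fact m) + f i j * \<rho> j"
      by (simp only: distrib_left sum_distrib_left times_divide_eq_right)
  qed simp
  also have "\<dots> = (\<Sum>m<n + 2. (\<Sum>j = 1..N. f i j * taylor_term U (?r j) m (x i)) / fact m) + (\<Sum>j = 1..N. f i j * \<rho> j)"
    by (simp only: sum.distrib sum_divide_distrib) (subst sum.swap, rule refl)
  also have "(\<Sum>m<n + 2. (\<Sum>j = 1..N. f i j * taylor_term U (?r j) m (x i)) / fact m)
      = (\<Sum>m<n + 2. if m = 2 then U 2 0 (x i) + U 0 2 (x i) else 0)"
  proof (intro sum.cong refl)
    fix m assume "m \<in> {..<n + 2}"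
    then have "m \<le> n + 1" by simp
    from stencil_taylor_sum[OF n c this, of U "x i"]
    show "(\<Sum>j = 1..N. f i j * taylor_term U (?r j) m (x i)) / fact m = (if m = 2 then U 2 0 (x i) + U 0 2 (x i) else 0)"
      by (simp only:) (simp split: if_splits)
  qed
  also have "\<dots> = U 2 0 (x i) + U 0 2 (x i)"
    using n by (subst sum.delta) auto
  finally have "\<bar>U 2 0 (x i) + U 0 2 (x i) - (\<Sum>j = 1..N. f i j * U 0 0 (x j))\<bar> = \<bar>\<Sum>j = 1..N. f i j * \<rho> j\<bar>"
    by simp
  also have "\<dots> \<le> (\<Sum>j = 1..N. \<bar>f i j * \<rho> j\<bar>)"
    by (rule sum_abs)
  also have "\<dots> \<le> (\<Sum>j = 1..N. 2 ^ (n + 2) * (R * h) ^ n * B * (f i j * (norm (?r j))\<^sup>2))"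
  proof (rule sum_mono)
    fix j assume j: "j \<in> {1..N}"
    show "\<bar>f i j * \<rho> j\<bar> \<le> 2 ^ (n + 2) * (R * h) ^ n * B * (f i j * (norm (?r j))\<^sup>2)"
    proof (cases "j \<in> neighbourhood h r R N x i")
      case False
      then show ?thesis using nb[OF j] by simp
    next
      case True
      have "\<bar>\<rho> j\<bar> = \<bar>taylor_term U (?r j) (n + 2) (\<zeta> j)\<bar> / fact (n + 2)"
        by (simp add: \<rho>_def abs_divide del: fact_Suc add_2_eq_Suc')
      also have "\<dots> \<le> \<bar>taylor_term U (?r j) (n + 2) (\<zeta> j)\<bar> / 1"
        by (intro divide_left_mono) (auto simp del: fact_Suc add_2_eq_Suc')
      also have "\<dots> \<le> 2 ^ (n + 2) * norm (?r j) ^ (n + 2) * B"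
        unfolding div_by_1 by (intro taylor_term_bound B) auto
      finally have \<rho>: "\<bar>\<rho> j\<bar> \<le> 2 ^ (n + 2) * norm (?r j) ^ (n + 2) * B" .
      show ?thesis
      \<comment> \<open>The diagonal weight can be negative, but the displacement is 0 there and the
        remainder vanishes.\<close>
      proof (cases "j = i")
        case True
        then show ?thesis using \<rho> by simp
      next
        case False
        then have f0: "f i j \<ge> 0" using c j by (auto simp: consistent_stencil_def)
        have "norm (?r j) \<le> R * h"
          using True False by (auto simp: neighbourhood_def norm_minus_commute)
        \<comment> \<open>Only n of the n + 2 powers are replaced by R h; the remaining square is
          kept for the second moments.\<close>
        then have "norm (?r j) ^ n * (norm (?r j))\<^sup>2 \<le> (R * h) ^ n * (norm (?r j))\<^sup>2"
          by (intro mult_right_mono power_mono) auto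
        then have "2 ^ (n + 2) * norm (?r j) ^ (n + 2) * B \<le> 2 ^ (n + 2) * ((R * h) ^ n * (norm (?r j))\<^sup>2) * B"
          by (intro mult_right_mono[OF mult_left_mono B0]) (simp_all only: power_add, simp)
        with \<rho> have "\<bar>\<rho> j\<bar> \<le> 2 ^ (n + 2) * ((R * h) ^ n * (norm (?r j))\<^sup>2) * B" by linarith
        then have "f i j * \<bar>\<rho> j\<bar> \<le> f i j * (2 ^ (n + 2) * ((R * h) ^ n * (norm (?r j))\<^sup>2) * B)"
          using f0 by (rule mult_left_mono)
        then show ?thesis using f0 by (simp add: abs_mult mult_ac)
      qed
    qed
  qed
  also have "\<dots> = 2 ^ (n + 2) * (R * h) ^ n * B * (\<Sum>j = 1..N. f i j * (norm (?r j))\<^sup>2)"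
    by (simp add: sum_distrib_left)
  also have "(\<Sum>j = 1..N. f i j * (norm (?r j))\<^sup>2)
      = (\<Sum>j = 1..N. f i j * (fst (?r j) * fst (?r j))) + (\<Sum>j = 1..N. f i j * (snd (?r j) * snd (?r j)))"
    by (simp add: norm_prod_def power2_eq_square[symmetric] distrib_left sum.distrib)
  also have "\<dots> = 4"
    using c unfolding consistent_stencil_def by linarith
  finally show ?thesis by (simp add: power_add mult_ac)
qed

text \<open>Both mollifications are compared with the double mollification, which is the same in
  either order. Each is Lipschitz, so the comparison has an explicit rate.\<close>

lemma conv_dist_le:
  assumes b: "mollifier e b" "e > 0" and b': "mollifier e' b'" "e' > 0"
    and v: "v \<in> borel_measurable borel" "locally_integrable v" and L: "L \<ge> 0"
    and lip: "\<And>x y. \<bar>conv b v 0 0 x - conv b v 0 0 y\<bar> \<le> L * norm (x - y)"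
      "\<And>x y. \<bar>conv b' v 0 0 x - conv b' v 0 0 y\<bar> \<le> L * norm (x - y)"
  shows "\<bar>conv b v 0 0 z - conv b' v 0 0 z\<bar> \<le> 2 * L * (e + e')"
proof -
  have "\<bar>conv b' (conv b v 0 0) 0 0 z - conv b v 0 0 z\<bar> \<le> 2 * L * e'"
    by (rule conv_lipschitz_approx[OF b' lip(1) L continuous_on_conv[OF b(1) v(2)]])
  moreover have "\<bar>conv b (conv b' v 0 0) 0 0 z - conv b' v 0 0 z\<bar> \<le> 2 * L * e"
    by (rule conv_lipschitz_approx[OF b lip(2) L continuous_on_conv[OF b'(1) v(2)]])
  ultimately show ?thesis
    unfolding conv_commute[OF b'(1) b(1) v] by (simp add: algebra_simps)
qed

section \<open>The continuous representative\<close>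

text \<open>One bound M for all second derivatives makes M h^2 a remainder bound for every n, and
  this inequality passes to the pointwise limit.\<close>

lemma has_real_derivative_limit:
  fixes f f1 f2 :: "nat \<Rightarrow> real \<Rightarrow> real"
  assumes "\<And>n t. (f n has_real_derivative f1 n t) (at t)" "\<And>n t. (f1 n has_real_derivative f2 n t) (at t)"
    and "\<And>n t. \<bar>f2 n t\<bar> \<le> M" and g: "\<And>t. (\<lambda>n. f n t) \<longlonglongrightarrow> g t" and g1: "(\<lambda>n. f1 n a) \<longlonglongrightarrow> D"
  shows "(g has_real_derivative D) (at a)"
proof (rule has_real_derivative_quadratic_error[of 1 _ _ _ M])
  fix h :: real
  have taylor: "\<bar>f n (a + h) - f n a - f1 n a * h\<bar> \<le> M * h\<^sup>2" for n
  proof -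
    have "\<exists>t. \<bar>t\<bar> \<le> \<bar>h\<bar> \<and> f n (a + h) = (\<Sum>m<2. (if m = 0 then f n (a + 0) else if m = 1 then f1 n (a + 0) else f2 n (a + 0)) / fact m * h ^ m) + f2 n (a + t) / fact 2 * h ^ 2"
      using assms Maclaurin_bi_le[of "\<lambda>m s. if m = 0 then f n (a + s) else if m = 1 then f1 n (a + s) else f2 n (a + s)" "\<lambda>s. f n (a + s)" 2 h]
      by (auto simp: less_2_cases_iff DERIV_shift[symmetric] add.commute[of a])
    then obtain t where "f n (a + h) = (\<Sum>m<2. (if m = 0 then f n (a + 0) else if m = 1 then f1 n (a + 0) else f2 n (a + 0)) / fact m * h ^ m) + f2 n (a + t) / fact 2 * h ^ 2"
      by blast
    then have "f n (a + h) - f n a - f1 n a * h = f2 n (a + t) / 2 * h\<^sup>2"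
      by (simp add: numeral_2_eq_2)
    moreover have "\<bar>f2 n (a + t) / 2\<bar> \<le> M" using assms(3)[of n "a + t"] by simp
    ultimately show ?thesis
      by (simp only: abs_mult abs_power2 mult_right_mono zero_le_power2)
  qed
  show "\<bar>g (a + h) - g a - D * h\<bar> \<le> M * h\<^sup>2"
  proof (rule LIMSEQ_le_const2)
    show "(\<lambda>n. \<bar>f n (a + h) - f n a - f1 n a * h\<bar>) \<longlonglongrightarrow> \<bar>g (a + h) - g a - D * h\<bar>"
      by (intro tendsto_intros g g1)
  qed (use taylor in blast)
qed simp

text \<open>The single B serves every mollifier, whatever its radius. Bounds reach order d + 2;
  convergence at a given order uses a Lipschitz constant from the next one, so it is obtained up to
  order d + 1.\<close>

locale mollified_bounds =
  fixes u :: "plane \<Rightarrow> real" and v :: "nat \<Rightarrow> nat \<Rightarrow> plane \<Rightarrow> real" and d :: nat and B :: real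
  assumes u: "u \<in> borel_measurable borel" "locally_integrable u"
    and weak: "i + j \<le> d + 1 \<Longrightarrow> is_weak_deriv (i, j) u (v i j)"
    and v: "i + j \<le> d + 1 \<Longrightarrow> v i j \<in> borel_measurable borel"
    and d: "1 \<le> d"
    and bound: "mollifier e b \<Longrightarrow> i + j \<le> d + 2 \<Longrightarrow> \<bar>conv b u i j z\<bar> \<le> B"
begin

lemma B_nonneg: "0 \<le> B"
proof -
  obtain b where "mollifier 1 b" using mollifier_exists[of 1] by auto
  from bound[OF this, of 0 0 0] show ?thesis by simp
qed

lemma conv_lip:
  assumes "mollifier e b" "i + j \<le> d + 1"
  shows "\<bar>conv b u i j x - conv b u i j y\<bar> \<le> 2 * B * norm (x - y)"
  by (rule conv_lipschitz[OF assms(1) u(2)]; rule bound[OF assms(1)]) (use assms(2) in auto)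

lemma conv_cauchy:
  assumes "mollifier e b" "e > 0" "mollifier e' b'" "e' > 0" "i + j \<le> d + 1"
  shows "\<bar>conv b u i j z - conv b' u i j z\<bar> \<le> 4 * B * (e + e')"
proof -
  have eq: "conv b u i j z = conv b (v i j) 0 0 z" if "mollifier e b" for e b z
    by (rule conv_weak_deriv[OF that weak[OF assms(5)]])
  have "locally_integrable (v i j)" using weak[OF assms(5)] by (simp add: is_weak_deriv_def)
  then have "\<bar>conv b (v i j) 0 0 z - conv b' (v i j) 0 0 z\<bar> \<le> 2 * (2 * B) * (e + e')"
    using conv_lip[OF assms(1,5)] conv_lip[OF assms(3,5)] B_nonneg
    by (intro conv_dist_le assms v) (simp_all add: eq[OF assms(1)] eq[OF assms(3)])
  then show ?thesis by (simp add: eq[OF assms(1)] eq[OF assms(3)])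
qed

definition radius :: "nat \<Rightarrow> real" where "radius n = 1 / (real n + 1)"

definition approximant :: "nat \<Rightarrow> nat \<Rightarrow> real \<Rightarrow> real" where
  "approximant n = (SOME b. mollifier (radius n) b)"

definition limit_deriv :: "nat \<Rightarrow> nat \<Rightarrow> plane \<Rightarrow> real" where
  "limit_deriv i j z = lim (\<lambda>n. conv (approximant n) u i j z)"

lemma radius_pos: "0 < radius n" by (simp add: radius_def)

lemma radius_tendsto: "radius \<longlonglongrightarrow> 0"
  using LIMSEQ_ignore_initial_segment[OF lim_1_over_n, of 1] by (simp add: radius_def[abs_def] add_ac)

lemma mollifier_approximant: "mollifier (radius n) (approximant n)"
  unfolding approximant_def using mollifier_exists[OF radius_pos] by (rule someI_ex)

lemma tendsto_limit_deriv:
  assumes ij: "i + j \<le> d + 1"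
  shows "(\<lambda>n. conv (approximant n) u i j z) \<longlonglongrightarrow> limit_deriv i j z"
proof -
  have "Cauchy (\<lambda>n. conv (approximant n) u i j z)"
  proof (rule metric_CauchyI)
    fix e :: real assume "e > 0"
    have "(\<lambda>n. 8 * B * radius n) \<longlonglongrightarrow> 8 * B * 0"
      by (intro tendsto_intros radius_tendsto)
    from order_tendstoD(2)[OF this, of e] \<open>e > 0\<close>
    obtain M where M: "\<And>n. n \<ge> M \<Longrightarrow> 8 * B * radius n < e"
      by (auto simp: eventually_sequentially)
    show "\<exists>M. \<forall>m\<ge>M. \<forall>n\<ge>M. dist (conv (approximant m) u i j z) (conv (approximant n) u i j z) < e"
    proof (intro exI allI impI)
      fix m n assume mn: "M \<le> m" "M \<le> n"
      have "dist (conv (approximant m) u i j z) (conv (approximant n) u i j z) \<le> 4 * B * (radius m + radius n)"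
        unfolding dist_real_def
        by (rule conv_cauchy[OF mollifier_approximant radius_pos mollifier_approximant radius_pos ij])
      then show "dist (conv (approximant m) u i j z) (conv (approximant n) u i j z) < e"
        using M[OF mn(1)] M[OF mn(2)] by (simp add: algebra_simps)
    qed
  qed
  then show ?thesis
    unfolding limit_deriv_def by (simp add: Cauchy_convergent_iff convergent_LIMSEQ_iff)
qed

lemma limit_deriv_dist:
  assumes "mollifier e b" "e > 0" "i + j \<le> d + 1"
  shows "\<bar>conv b u i j z - limit_deriv i j z\<bar> \<le> 4 * B * e"
proof (rule LIMSEQ_le)
  show "(\<lambda>n. \<bar>conv b u i j z - conv (approximant n) u i j z\<bar>) \<longlonglongrightarrow> \<bar>conv b u i j z - limit_deriv i j z\<bar>"
    by (intro tendsto_intros tendsto_limit_deriv assms)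
  have "(\<lambda>n. 4 * B * (e + radius n)) \<longlonglongrightarrow> 4 * B * (e + 0)"
    by (intro tendsto_intros radius_tendsto)
  then show "(\<lambda>n. 4 * B * (e + radius n)) \<longlonglongrightarrow> 4 * B * e" by simp
  show "\<exists>N. \<forall>n\<ge>N. \<bar>conv b u i j z - conv (approximant n) u i j z\<bar> \<le> 4 * B * (e + radius n)"
    using conv_cauchy[OF assms(1,2) mollifier_approximant radius_pos assms(3)] by blast
qed

lemma limit_deriv_lip:
  assumes "i + j \<le> d + 1"
  shows "\<bar>limit_deriv i j x - limit_deriv i j y\<bar> \<le> 2 * B * norm (x - y)"
proof (rule LIMSEQ_le_const2)
  show "(\<lambda>n. \<bar>conv (approximant n) u i j x - conv (approximant n) u i j y\<bar>) \<longlonglongrightarrow> \<bar>limit_deriv i j x - limit_deriv i j y\<bar>"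
    by (intro tendsto_intros tendsto_limit_deriv assms)
qed (use conv_lip[OF mollifier_approximant assms] in blast)

lemma continuous_on_limit_deriv:
  assumes "i + j \<le> d + 1"
  shows "continuous_on UNIV (limit_deriv i j)"
proof -
  have "(2 * B)-lipschitz_on UNIV (limit_deriv i j)"
    using limit_deriv_lip[OF assms] B_nonneg by (auto intro!: lipschitz_onI simp: dist_norm)
  then show ?thesis by (rule lipschitz_on_continuous_on)
qed

text \<open>The mollifications of u and of the Lipschitz limit both lie within 4 B e of the limit,
  so the difference has mollifications of size at most 8 B e and is null.\<close>

lemma AE_limit_deriv: "AE z in lborel. u z - limit_deriv 0 0 z = 0"
proof (rule AE_zero_of_conv_small)
  have c: "continuous_on UNIV (limit_deriv 0 0)" by (rule continuous_on_limit_deriv) simp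
  have li: "locally_integrable (limit_deriv 0 0)" by (rule locally_integrable_continuous[OF c])
  show "(\<lambda>z. u z - limit_deriv 0 0 z) \<in> borel_measurable borel"
    using u(1) borel_measurable_continuous_onI[OF c] by simp
  show "locally_integrable (\<lambda>z. u z - limit_deriv 0 0 z)"
    using u(2) li by (auto simp: locally_integrable_def intro!: set_integral_diff)
  fix e :: real assume e: "0 < e" "e < 1"
  then obtain b where b: "mollifier e b" using mollifier_exists by blast
  have "\<bar>conv b (\<lambda>z. u z - limit_deriv 0 0 z) 0 0 z\<bar> \<le> 8 * B * e" for z
  proof -
    have "conv b (\<lambda>z. u z - limit_deriv 0 0 z) 0 0 z = conv b u 0 0 z - conv b (limit_deriv 0 0) 0 0 z"
      unfolding conv_def left_diff_distrib
      by (intro Bochner_Integration.integral_diff conv_integrable[OF b] u(2) li)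
    moreover have "\<bar>conv b u 0 0 z - limit_deriv 0 0 z\<bar> \<le> 4 * B * e"
      by (rule limit_deriv_dist[OF b e(1)]) simp
    moreover have "\<bar>conv b (limit_deriv 0 0) 0 0 z - limit_deriv 0 0 z\<bar> \<le> 2 * (2 * B) * e"
      using B_nonneg by (intro conv_lipschitz_approx[OF b e(1) limit_deriv_lip _ c]) auto
    ultimately show ?thesis by linarith
  qed
  then show "\<exists>b. mollifier e b \<and> (\<forall>z. \<bar>conv b (\<lambda>z. u z - limit_deriv 0 0 z) 0 0 z\<bar> \<le> 8 * B * e)"
    using b by blast
qed

lemma continuous_rep_eq: "continuous_rep u = limit_deriv 0 0"
  unfolding continuous_rep_def
proof (rule the_equality)
  have 1: "continuous_on UNIV (limit_deriv 0 0)" by (rule continuous_on_limit_deriv) simp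
  have 2: "AE z in lborel. limit_deriv 0 0 z = u z"
    using AE_limit_deriv by eventually_elim simp
  show "continuous_on UNIV (limit_deriv 0 0) \<and> (AE z in lborel. limit_deriv 0 0 z = u z)"
    using 1 2 ..
  fix \<phi> assume \<phi>: "continuous_on UNIV \<phi> \<and> (AE z in lborel. \<phi> z = u z)"
  have "AE z in lborel. \<phi> z = limit_deriv 0 0 z"
    using conjunct2[OF \<phi>] 2 by eventually_elim simp
  then show "\<phi> = limit_deriv 0 0" using \<phi> 1 by (intro continuous_AE_eq) auto
qed

text \<open>The limit argument takes convergence at orders i + j and i + j + 1 and a bound at order
  i + j + 2, which is exactly available for i + j <= d.\<close>

lemma partial_limit_deriv:
  assumes "i + j \<le> d"
  shows "partial_x (limit_deriv i j) = limit_deriv (Suc i) j"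
    and "partial_y (limit_deriv i j) = limit_deriv i (Suc j)"
proof -
  have along: "((\<lambda>t. conv (approximant n) u i j (z + t *\<^sub>R w)) has_real_derivative
     fst w * conv (approximant n) u (Suc i) j (z + t *\<^sub>R w) + snd w * conv (approximant n) u i (Suc j) (z + t *\<^sub>R w)) (at t)"
    for i j n z w t
    by (rule has_derivative_imp_deriv_along[OF has_derivative_conv[OF mollifier_approximant u(2)]])
  have x: "((\<lambda>s. conv (approximant n) u i j (s, t)) has_real_derivative conv (approximant n) u (Suc i) j (s, t)) (at s)"
    for i j n s t
    using along[of n i j "(0, t)" "(1, 0)" s] by simp
  have y: "((\<lambda>t. conv (approximant n) u i j (s, t)) has_real_derivative conv (approximant n) u i (Suc j) (s, t)) (at t)"
    for i j n s t
    using along[of n i j "(s, 0)" "(0, 1)" t] by simp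
  have "((\<lambda>s. limit_deriv i j (s, t)) has_real_derivative limit_deriv (Suc i) j (s, t)) (at s)" for s t
    by (rule has_real_derivative_limit[where M = B, OF x x bound[OF mollifier_approximant] tendsto_limit_deriv tendsto_limit_deriv])
      (use assms in auto)
  then show "partial_x (limit_deriv i j) = limit_deriv (Suc i) j"
    by (auto simp: partial_x_def fun_eq_iff intro!: DERIV_imp_deriv)
  have "((\<lambda>t. limit_deriv i j (s, t)) has_real_derivative limit_deriv i (Suc j) (s, t)) (at t)" for s t
    by (rule has_real_derivative_limit[where M = B, OF y y bound[OF mollifier_approximant] tendsto_limit_deriv tendsto_limit_deriv])
      (use assms in auto)
  then show "partial_y (limit_deriv i j) = limit_deriv i (Suc j)"
    by (auto simp: partial_y_def fun_eq_iff intro!: DERIV_imp_deriv)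
qed

lemma laplacian_continuous_rep:
  "laplacian (continuous_rep u) z = limit_deriv 2 0 z + limit_deriv 0 2 z"
  using d by (simp add: laplacian_def continuous_rep_eq mpartial_def numeral_2_eq_2 partial_limit_deriv)

text \<open>Derivatives of order d + 2 are controlled for mollifications only, so
  \<open>stencil_error\<close> is applied to these and the inequality passes to the limit. It
  mentions orders 0 and 2, which converge because 2 <= d + 1.\<close>

lemma stencil_error_continuous_rep:
  assumes c: "consistent_stencil d N x f i" and i: "i \<in> {1..N}"
    and nb: "\<And>j. j \<in> {1..N} \<Longrightarrow> j \<notin> neighbourhood h r R N x i \<Longrightarrow> f i j = 0"
    and Rh: "0 \<le> R * h"
  shows "\<bar>laplacian (continuous_rep u) (x i) - (\<Sum>j = 1..N. f i j * continuous_rep u (x j))\<bar> \<le> 2 ^ (d + 4) * B * (R * h) ^ d"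
proof (rule LIMSEQ_le_const2)
  show "(\<lambda>n. \<bar>conv (approximant n) u 2 0 (x i) + conv (approximant n) u 0 2 (x i) - (\<Sum>j = 1..N. f i j * conv (approximant n) u 0 0 (x j))\<bar>)
    \<longlonglongrightarrow> \<bar>laplacian (continuous_rep u) (x i) - (\<Sum>j = 1..N. f i j * continuous_rep u (x j))\<bar>"
    unfolding laplacian_continuous_rep unfolding continuous_rep_eq
    by (intro tendsto_intros tendsto_limit_deriv) (use d in auto)
  have "\<bar>conv (approximant n) u 2 0 (x i) + conv (approximant n) u 0 2 (x i) - (\<Sum>j = 1..N. f i j * conv (approximant n) u 0 0 (x j))\<bar>
      \<le> 2 ^ (d + 4) * B * (R * h) ^ d" for n
    using stencil_error[where U = "conv (approximant n) u", OF d c i nb Rh has_derivative_conv[OF mollifier_approximant u(2)]]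
      bound[OF mollifier_approximant] by simp
  then show "\<exists>M. \<forall>n\<ge>M. \<bar>conv (approximant n) u 2 0 (x i) + conv (approximant n) u 0 2 (x i) - (\<Sum>j = 1..N. f i j * conv (approximant n) u 0 0 (x j))\<bar>
      \<le> 2 ^ (d + 4) * B * (R * h) ^ d" by blast
qed

end

section \<open>From the Sobolev norm to the estimate for particle clouds\<close>

lemma finite_multi_indices: "finite {\<alpha> :: multi_index. midx_size \<alpha> \<le> k}"
  by (rule finite_subset[of _ "{..k} \<times> {..k}"]) auto

text \<open>\<^const>\<open>weak_deriv\<close> is an arbitrary choice; that it is $p$-integrable, so that the integrals
  in \<^const>\<open>sobolev_norm\<close> are not the junk value 0, rests on the uniqueness of weak derivatives.\<close>

lemma sobolev_weak_deriv:
  assumes p: "p \<ge> 1" and u: "u \<in> sobolev_space k p" and S: "sobolev_norm k p u < S" and ij: "i + j \<le> k"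
  shows "is_weak_deriv (i, j) u (weak_deriv (i, j) u)" "weak_deriv (i, j) u \<in> borel_measurable borel"
    and "(\<integral>\<^sup>+z. ennreal (\<bar>weak_deriv (i, j) u z\<bar> powr p) \<partial>lborel) \<le> ennreal (S powr p)"
proof -
  have weak: "is_weak_deriv \<alpha> u (weak_deriv \<alpha> u)" "weak_deriv \<alpha> u \<in> borel_measurable borel"
    "integrable lborel (\<lambda>z. \<bar>weak_deriv \<alpha> u z\<bar> powr p)" if midx: "midx_size \<alpha> \<le> k" for \<alpha>
  proof -
    obtain w where w: "w \<in> Lp p" "is_weak_deriv \<alpha> u w"
      using u midx unfolding sobolev_space_def by blast
    then have "\<exists>w. w \<in> borel_measurable lborel \<and> is_weak_deriv \<alpha> u w"
      by (auto simp: Lp_def)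
    from someI_ex[OF this] have v: "weak_deriv \<alpha> u \<in> borel_measurable lborel \<and> is_weak_deriv \<alpha> u (weak_deriv \<alpha> u)"
      by (simp add: weak_deriv_def)
    then show a: "is_weak_deriv \<alpha> u (weak_deriv \<alpha> u)" and m: "weak_deriv \<alpha> u \<in> borel_measurable borel"
      by auto
    have wm: "w \<in> borel_measurable borel" and wi: "integrable lborel (\<lambda>z. \<bar>w z\<bar> powr p)"
      using w(1) by (auto simp: Lp_def)
    have "AE z in lborel. weak_deriv \<alpha> u z = w z"
      using weak_deriv_unique[of "fst \<alpha>" "snd \<alpha>" u "weak_deriv \<alpha> u" w] a w(2) m wm by simp
    then have "AE z in lborel. \<bar>w z\<bar> powr p = \<bar>weak_deriv \<alpha> u z\<bar> powr p"
      by eventually_elim simp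
    then show "integrable lborel (\<lambda>z. \<bar>weak_deriv \<alpha> u z\<bar> powr p)"
      by (rule integrable_cong_AE_imp[OF wi, rotated]) (use m in measurable)
  qed
  show "is_weak_deriv (i, j) u (weak_deriv (i, j) u)" "weak_deriv (i, j) u \<in> borel_measurable borel"
    using weak[of "(i, j)"] ij by auto
  let ?I = "\<lambda>\<alpha>. \<integral>z. \<bar>weak_deriv \<alpha> u z\<bar> powr p \<partial>lborel"
  let ?s = "\<Sum>\<alpha> | midx_size \<alpha> \<le> k. ?I \<alpha>"
  have nn: "?I \<alpha> \<ge> 0" for \<alpha> by (rule integral_nonneg_AE) simp
  have "?I (i, j) \<le> ?s"
    using ij nn by (intro member_le_sum finite_multi_indices) auto
  also have "?s = (?s powr (1 / p)) powr p"
    using p sum_nonneg[of _ ?I] nn by (simp add: powr_powr)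
  also have "\<dots> \<le> S powr p"
    using S p unfolding sobolev_norm_def by (intro powr_mono2) auto
  finally have "?I (i, j) \<le> S powr p" .
  then show "(\<integral>\<^sup>+z. ennreal (\<bar>weak_deriv (i, j) u z\<bar> powr p) \<partial>lborel) \<le> ennreal (S powr p)"
    using weak(3)[of "(i, j)"] ij by (subst nn_integral_eq_integral) (auto intro!: ennreal_leI)
qed

lemma sobolev_norm_nonneg: "sobolev_norm k p u \<ge> 0"
  by (simp add: sobolev_norm_def)

lemma sobolev_const_nonneg: "p \<ge> 1 \<Longrightarrow> sobolev_const p \<ge> 0"
  by (auto simp: sobolev_const_def divide_le_eq)

lemma sobolev_mollified_bounds:
  assumes p: "p \<ge> 1" and u: "u \<in> sobolev_space k p" and S: "sobolev_norm k p u < S"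
    and d: "1 \<le> d" "real k > 2 / p + real d + 2"
  shows "mollified_bounds u (\<lambda>i j. weak_deriv (i, j) u) d (sobolev_const p * S)"
proof
  have S0: "S > 0" using S sobolev_norm_nonneg[of k p u] by linarith
  have "2 / p > 0" using p by simp
  then have k: "d + 2 \<le> k" using d(2) by linarith
  note w = sobolev_weak_deriv[OF p u S]
  show "u \<in> borel_measurable borel"
    using u by (simp add: sobolev_space_def Lp_def)
  show li: "locally_integrable u"
    using w(1)[of 0 0] by (simp add: is_weak_deriv_def)
  show "is_weak_deriv (i, j) u (weak_deriv (i, j) u)" "weak_deriv (i, j) u \<in> borel_measurable borel"
    if "i + j \<le> d + 1" for i j
    using w(1,2)[of i j] that k by auto
  show "1 \<le> d" by fact
  show "\<bar>conv b u i j z\<bar> \<le> sobolev_const p * S" if "mollifier e b" "i + j \<le> d + 2" for e b i j z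
  proof (rule conv_bound[OF that(1) p S0 _ li w])
    have "real (i + j) \<le> real (d + 2)" using that(2) by (rule of_nat_mono)
    then show "real (i + j) + 2 / p < real k" using d(2) by simp
  qed
qed

lemma cloud_error_bound:
  assumes p: "p \<ge> 1" and u: "u \<in> sobolev_space k p"
    and d: "1 \<le> d" "real k > 2 / p + real d + 2"
    and adm: "admissible_stencils d h r R N \<Gamma> x f" and pos: "h > 0" "r > 0" "R > r"
  shows "\<bar>(dist_laplacian (cloud N \<Gamma> x) - discrete_laplacian N f \<Gamma> x) (continuous_rep u)\<bar>
    \<le> 2 ^ (d + 4) * sobolev_const p * (R * h) ^ d * (\<Sum>i = 1..N. \<bar>\<Gamma> i\<bar>) * sobolev_norm k p u"
proof -
  let ?\<phi> = "continuous_rep u"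
  let ?K = "2 ^ (d + 4) * sobolev_const p * (R * h) ^ d * (\<Sum>i = 1..N. \<bar>\<Gamma> i\<bar>)"
  let ?E = "\<lambda>i. laplacian ?\<phi> (x i) - (\<Sum>j = 1..N. f i j * ?\<phi> (x j))"
  have Rh: "0 \<le> R * h" using pos by simp
  have eq: "(dist_laplacian (cloud N \<Gamma> x) - discrete_laplacian N f \<Gamma> x) ?\<phi> = (\<Sum>i = 1..N. \<Gamma> i * ?E i)"
    by (simp add: dist_laplacian_def cloud_def discrete_laplacian_def dirac_def right_diff_distrib
      sum_subtractf sum_distrib_left mult_ac)
  have K0: "?K \<ge> 0"
    using Rh sobolev_const_nonneg[OF p] by (auto intro!: mult_nonneg_nonneg sum_nonneg)
  have bound: "\<bar>\<Sum>i = 1..N. \<Gamma> i * ?E i\<bar> \<le> ?K * S" if S: "sobolev_norm k p u < S" for S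
  proof -
    interpret mollified_bounds u "\<lambda>i j. weak_deriv (i, j) u" d "sobolev_const p * S"
      by (rule sobolev_mollified_bounds[OF p u S d])
    have "\<bar>\<Sum>i = 1..N. \<Gamma> i * ?E i\<bar> \<le> (\<Sum>i = 1..N. \<bar>\<Gamma> i * ?E i\<bar>)" by (rule sum_abs)
    also have "\<dots> \<le> (\<Sum>i = 1..N. \<bar>\<Gamma> i\<bar> * (2 ^ (d + 4) * (sobolev_const p * S) * (R * h) ^ d))"
    proof (rule sum_mono)
      fix i assume i: "i \<in> {1..N}"
      show "\<bar>\<Gamma> i * ?E i\<bar> \<le> \<bar>\<Gamma> i\<bar> * (2 ^ (d + 4) * (sobolev_const p * S) * (R * h) ^ d)"
      \<comment> \<open>Particles with an all-zero stencil have circulation 0 and contribute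
        nothing.\<close>
      proof (cases "\<Gamma> i = 0")
        case False
        then have "consistent_stencil d N x f i"
          and "\<And>j. j \<in> {1..N} \<Longrightarrow> j \<notin> neighbourhood h r R N x i \<Longrightarrow> f i j = 0"
          using adm i by (auto simp: admissible_stencils_def)
        from stencil_error_continuous_rep[OF this(1) i this(2) Rh] show ?thesis
          unfolding abs_mult by (intro mult_left_mono) auto
      qed simp
    qed
    also have "\<dots> = ?K * S" by (simp add: sum_distrib_left sum_distrib_right mult_ac)
    finally show ?thesis .
  qed
  \<comment> \<open>The balancing in \<open>square_bound\<close> takes a positive S, while the norm
    is so far only known to be nonnegative. The estimate therefore holds for each S above the norm,
    and S decreases to it.\<close>
  have "\<bar>\<Sum>i = 1..N. \<Gamma> i * ?E i\<bar> \<le> ?K * sobolev_norm k p u"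
  proof (rule tendsto_lowerbound)
    show "((\<lambda>S. ?K * S) \<longlongrightarrow> ?K * sobolev_norm k p u) (at_right (sobolev_norm k p u))"
      by (intro tendsto_intros)
    show "\<forall>\<^sub>F S in at_right (sobolev_norm k p u). \<bar>\<Sum>i = 1..N. \<Gamma> i * ?E i\<bar> \<le> ?K * S"
      using eventually_at_right_less by eventually_elim (rule bound)
  qed simp
  then show ?thesis by (simp only: eq)
qed

theorem theorem1:
  fixes n k :: nat and p :: real and q :: ennreal
  assumes "n \<in> {1, 2}"
    and "1 \<le> p"
    and "1 / ennreal p + 1 / q = 1"
    and "real k > 2 / p + real n + 2"
  shows "\<exists>C :: real. \<forall>(h :: real) (r :: real) (R :: real) (N :: nat)
           (\<Gamma> :: nat \<Rightarrow> real) (x :: nat \<Rightarrow> real \<times> real) (f :: nat \<Rightarrow> nat \<Rightarrow> real).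
           h > 0 \<and> r > 0 \<and> R > r \<and> N \<ge> 1 \<and> admissible_stencils n h r R N \<Gamma> x f \<longrightarrow>
           neg_sobolev_norm k q
               (dist_laplacian (cloud N \<Gamma> x) - discrete_laplacian N f \<Gamma> x)
             \<le> ereal (C * (R / r)\<^sup>2 * (R * h) ^ n * (\<Sum>i = 1..N. \<bar>\<Gamma> i\<bar>))"
proof (intro exI allI impI)
  fix h r R :: real and N :: nat and \<Gamma> :: "nat \<Rightarrow> real" and x :: "nat \<Rightarrow> real \<times> real" and f :: "nat \<Rightarrow> nat \<Rightarrow> real"
  assume *: "h > 0 \<and> r > 0 \<and> R > r \<and> N \<ge> 1 \<and> admissible_stencils n h r R N \<Gamma> x f"
  let ?C = "2 ^ (n + 4) * sobolev_const p"
  let ?\<mu> = "dist_laplacian (cloud N \<Gamma> x) - discrete_laplacian N f \<Gamma> x"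
  let ?K = "?C * (R * h) ^ n * (\<Sum>i = 1..N. \<bar>\<Gamma> i\<bar>)"
  have K0: "?K \<ge> 0"
    using * sobolev_const_nonneg[OF assms(2)] by (auto intro!: mult_nonneg_nonneg sum_nonneg)
  \<comment> \<open>The bound \<open>?K\<close> is free of the ratio; R > r > 0 makes multiplication
    by its square a weakening to the stated form.\<close>
  have "1 \<le> (R / r)\<^sup>2" using * by (simp add: one_le_power)
  then have KC: "?K \<le> ?C * (R / r)\<^sup>2 * (R * h) ^ n * (\<Sum>i = 1..N. \<bar>\<Gamma> i\<bar>)"
    using mult_left_mono[OF _ K0, of 1 "(R / r)\<^sup>2"] by (simp add: mult_ac)
  show "neg_sobolev_norm k q ?\<mu> \<le> ereal (?C * (R / r)\<^sup>2 * (R * h) ^ n * (\<Sum>i = 1..N. \<bar>\<Gamma> i\<bar>))"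
    unfolding neg_sobolev_norm_def conjugate_exponent_eq[OF assms(2,3)] sobolev_dual_norm_def
  proof (rule SUP_least)
    fix u assume "u \<in> {\<phi> \<in> sobolev_space k p. \<not> (AE z in lborel. \<phi> z = 0)}"
    then have "\<bar>?\<mu> (continuous_rep u)\<bar> \<le> ?K * sobolev_norm k p u"
      using * assms by (intro cloud_error_bound[where r = r]) auto
    \<comment> \<open>Should the norm be 0, the quotient has the default value 0, which the
      nonnegative \<open>?K\<close> still bounds.\<close>
    then have "?\<mu> (continuous_rep u) / sobolev_norm k p u \<le> ?K"
      using K0 sobolev_norm_nonneg[of k p u] by (cases "sobolev_norm k p u = 0") (auto simp: divide_le_eq)
    from order_trans[OF this KC] show "ereal (?\<mu> (continuous_rep u) / sobolev_norm k p u)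
        \<le> ereal (?C * (R / r)\<^sup>2 * (R * h) ^ n * (\<Sum>i = 1..N. \<bar>\<Gamma> i\<bar>))"
      by (simp only: ereal_less_eq)
  qed
qed

end
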